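(* Let $\{X_n, n\ge1\}$ be independent and identically distributed random variables with values in a countably infinite alphabet $\mathcal{A}=\{a_i: i\ge1\}$ and common nonuniform distribution $\{p_i, i\ge1\}$, $p_i=\mathbb{P}(X_1=a_i)$. Assume that for some $0<\delta<\frac12$ we have $\mathbb{E}|\ln p(X_1)|^{2+\delta}<\infty$ and there exist a positive-integer-valued function $K(n)$ and a constant $C_0$ such that, for all $n\ge1$, $$K(n)\le n^{\frac12-\delta},\qquad n^{\frac12+\delta}\ln n\sum_{i=K(n)}^\infty p_i\le C_0,\qquad -n^{\frac12+\delta}\sum_{i=K(n)}^\infty p_i\ln p_i\le C_0.$$ Assume further that there exists $\epsilon\in(1/2,1)$ with $$\sum_{i=1}^\infty p_i^{1-\epsilon}<\infty.$$ Let $H=-\sum_{i=1}^\infty p_i\ln p_i$, let $\sigma^2=\mathrm{Var}(\ln p(X_1))$, $\sigma>0$, and let $\hat H_{JK}$ be the jackknife entropy estimator based on $X_1,\dots,X_n$. Then there is a constant $C>0$, not depending on $n$, such that for every $n\ge2$, $$\sup_{x\in\mathbb{R}}\left|\mathbb{P}\left(\frac{\sqrt n}{\sigma}(\hat H_{JK}-H)\le x\right)-\Phi(x)\right|\le C n^{-\frac{\delta}{2}}+C n^{\frac14-\frac{\epsilon}{2}},$$ where $\Phi$ is the standard normal distribution function.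
   Context: $p(X_1)$ denotes the random variable equal to $p_i$ on the event $\{X_1=a_i\}$. Some $p_i$ may be zero; the conventions $0\ln 0=0$ and $0^{1-\epsilon}=0$ are used. "Nonuniform" means that the positive $p_i$ are not all equal, equivalently $\mathrm{Var}(\ln p(X_1))>0$. For each $n$, with $I_A$ the indicator of the event $A$, let $\hat p_i=\frac1n\sum_{k=1}^n I_{\{X_k=a_i\}}$ and let $\hat H_n=-\sum_{i=1}^\infty\hat p_i\ln\hat p_i$ be the plug-in estimator. For $n\ge2$ and $j\in\{1,\dots,n\}$ let $$\hat p_i^{(j)}=\frac1{n-1}\Big(\sum_{k=1}^n I_{\{X_k=a_i\}}-I_{\{X_j=a_i\}}\Big),\qquad \hat H_n^{(j)}=-\sum_{i=1}^\infty\hat p_i^{(j)}\ln\hat p_i^{(j)}$$ (the plug-in estimator from the sample with the $j$th observation deleted). The jackknife estimator is $$\hat H_{JK}=n\hat H_n-(n-1)\,\frac{\sum_{j=1}^n\hat H_n^{(j)}}{n}.$$ *)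

theory Defs
  imports "HOL-Probability.Probability"
begin

text \<open>Throughout, letters, probabilities and observations are indexed from 1; values at index 0
  are never used.\<close>

definition nonuniform :: "(nat \<Rightarrow> real) \<Rightarrow> bool" where
  "nonuniform p \<longleftrightarrow> (\<exists>i\<ge>1. \<exists>j\<ge>1. p i > 0 \<and> p j > 0 \<and> p i \<noteq> p j)"

text \<open>The map sending \<open>a i\<close> to \<open>p i\<close>, for \<open>a\<close> injective on the indices \<open>i \<ge> 1\<close>;
  composed with \<open>X 1\<close> it is the random variable \<open>p(X\<^sub>1)\<close>.\<close>

definition letter_mass :: "(nat \<Rightarrow> 'a) \<Rightarrow> (nat \<Rightarrow> real) \<Rightarrow> 'a \<Rightarrow> real" where
  "letter_mass a p x = p (inv_into {1..} a x)"

text \<open>Since \<open>0 * y = 0\<close>, this respects the convention \<open>0 ln 0 = 0\<close>.\<close>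

definition entropy_of :: "(nat \<Rightarrow> real) \<Rightarrow> real" where
  "entropy_of p = - (\<Sum>\<^sub>\<infinity>i\<in>{1..}. p i * ln (p i))"

definition emp_freq :: "(nat \<Rightarrow> 'a) \<Rightarrow> (nat \<Rightarrow> 'w \<Rightarrow> 'a) \<Rightarrow> nat \<Rightarrow> 'w \<Rightarrow> nat \<Rightarrow> real" where
  "emp_freq a X n w i = (\<Sum>k=1..n. of_bool (X k w = a i)) / real n"

definition emp_freq_del ::
  "(nat \<Rightarrow> 'a) \<Rightarrow> (nat \<Rightarrow> 'w \<Rightarrow> 'a) \<Rightarrow> nat \<Rightarrow> nat \<Rightarrow> 'w \<Rightarrow> nat \<Rightarrow> real" where
  "emp_freq_del a X n j w i =
     ((\<Sum>k=1..n. of_bool (X k w = a i)) - of_bool (X j w = a i)) / (real n - 1)"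

definition plugin_entropy :: "(nat \<Rightarrow> 'a) \<Rightarrow> (nat \<Rightarrow> 'w \<Rightarrow> 'a) \<Rightarrow> nat \<Rightarrow> 'w \<Rightarrow> real" where
  "plugin_entropy a X n w = entropy_of (emp_freq a X n w)"

definition plugin_entropy_del ::
  "(nat \<Rightarrow> 'a) \<Rightarrow> (nat \<Rightarrow> 'w \<Rightarrow> 'a) \<Rightarrow> nat \<Rightarrow> nat \<Rightarrow> 'w \<Rightarrow> real" where
  "plugin_entropy_del a X n j w = entropy_of (emp_freq_del a X n j w)"

definition jackknife_entropy :: "(nat \<Rightarrow> 'a) \<Rightarrow> (nat \<Rightarrow> 'w \<Rightarrow> 'a) \<Rightarrow> nat \<Rightarrow> 'w \<Rightarrow> real" where
  "jackknife_entropy a X n w =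
     real n * plugin_entropy a X n w
       - (real n - 1) * ((\<Sum>j=1..n. plugin_entropy_del a X n j w) / real n)"

end

theory Submission
  imports Defs
begin

text \<open>Write \<open>H\<^sub>n\<close> for the plug-in estimator, \<open>c\<^sub>i\<close> for the number of occurrences of the \<open>i\<close>-th letter
  and \<open>D\<close> for the relative entropy of the empirical distribution with respect to \<open>p\<close>. Then
  \<open>H\<^sub>n = - (1/n) \<Sum>\<^sub>k ln p(X\<^sub>k) - D\<close>, and the jackknife adds to it
  \<open>\<Sum>\<^sub>i (c\<^sub>i/n) (\<phi>(n) - \<phi>(c\<^sub>i))\<close> with \<open>\<phi>(m) = (m - 1) ln (m / (m - 1))\<close>, which in absolute value is at
  most the number of distinct observed letters divided by \<open>n\<close>. Splitting the alphabet at \<open>K(n)\<close>, both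
  remainders have expectation \<open>O(n powr (- 1/2 - \<delta>))\<close>, so by Markov's inequality they move the
  distribution function of the normalised sum of the \<open>- ln p(X\<^sub>k) - H\<close> by \<open>O(n powr (- \<delta>/2))\<close>. The sum
  itself is handled by a Berry--Esseen theorem for finite \<open>(2 + \<delta>)\<close>-th moments, proved from
  Levy's inversion formula after smoothing with a small Gaussian.\<close>

section \<open>A smoothing inequality\<close>

text \<open>The chi-square term of a letter has expectation of order 1/n however rare the letter is,
  so it cannot be summed over the infinite alphabet; the cross entropy can be summed, but is not
  small on frequent letters. The cutoff K(n) balances the two: K(n)/n against the tail sums. After
  multiplication by sqrt n the remainder has mean O(n powr (- \<delta>)), and the Markov threshold n
  powr (- \<delta>/2) equates the shift of the argument with the exceptional probability.

  As \<delta> < 1/2, errors of order n powr (- 1/4) are harmless in the normal approximation. This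
  permits a Gaussian kernel whose effect is undone by Chebyshev's inequality alone. Above
  frequencies of order sqrt n the characteristic function of the sum has only the trivial bound 1,
  since ln p(X) may be lattice valued; there all decay comes from the kernel, whose width must
  exceed n powr (- 1/2) by a power of n.\<close>

lemma Levy_Inversion_diff:
  fixes \<mu> \<nu> :: "real measure" and g :: "real \<Rightarrow> real"
  assumes \<mu>: "real_distribution \<mu>" and \<nu>: "real_distribution \<nu>" and ab: "a \<le> b"
    and atoms: "measure \<mu> {a} = 0" "measure \<mu> {b} = 0" "measure \<nu> {a} = 0" "measure \<nu> {b} = 0"
    and g: "integrable lborel g" "\<And>t. 0 \<le> g t"
    and le: "\<And>t. cmod (char \<mu> t - char \<nu> t) \<le> \<bar>t\<bar> * g t"
  shows "\<bar>measure \<mu> {a<..b} - measure \<nu> {a<..b}\<bar> \<le> (\<integral>t. g t \<partial>lborel) / pi"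
proof -
  interpret \<mu>: real_distribution \<mu> by fact
  interpret \<nu>: real_distribution \<nu> by fact
  define F where "F t = (iexp (-(t * a)) - iexp (-(t * b))) / (\<i> * complex_of_real t)" for t :: real
  have F_meas [measurable]: "F \<in> borel_measurable borel"
    unfolding F_def by measurable
  have F_le: "cmod (F t) \<le> b - a" for t
  proof (cases "t = 0")
    case True
    with ab show ?thesis by (simp add: F_def)
  next
    case False
    have "F t = (iexp (t * (-a)) - iexp (t * (-b))) / (\<i> * t)"
      by (simp add: F_def)
    also have "cmod \<dots> \<le> -a - (-b)"
      using Levy_Inversion_aux2[of "-b" "-a" t] ab False by simp
    finally show ?thesis by simp
  qed
  \<comment> \<open>\<open>F_le\<close> serves for integrability on bounded intervals. This second
    bound does not involve the endpoints and cancels the factor \<open>\<bar>t\<bar>\<close> of the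
    hypothesis, so the final estimate is uniform in \<open>a\<close> and \<open>b\<close>.\<close>
  have F_le2: "cmod (F t) \<le> 2 / \<bar>t\<bar>" for t
  proof -
    have "cmod (iexp (-(t * a)) - iexp (-(t * b))) \<le> cmod (iexp (-(t * a))) + cmod (iexp (-(t * b)))"
      by (rule norm_triangle_ineq4)
    also have "\<dots> = 2" by simp
    finally show ?thesis
      unfolding F_def norm_divide norm_mult by (auto intro: divide_right_mono)
  qed
  have int: "complex_set_integrable lborel {-T<..<T} (\<lambda>t. F t * char M t)"
    if "real_distribution M" for M and T :: real
  proof -
    interpret M: real_distribution M by fact
    have "cmod (F t * char M t) \<le> b - a" for t
      using mult_mono[OF F_le[of t] M.cmod_char_le_1[of t]] ab by (simp add: norm_mult)
    then show ?thesis
      unfolding set_integrable_def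
      by (intro integrableI_bounded_set_indicator[where B="b - a"]) (use emeasure_bounded_finite[of "{-T<..<T}"] in auto)
  qed
  have *: "cmod ((CLBINT t=-T..T. F t * char \<mu> t) - (CLBINT t=-T..T. F t * char \<nu> t))
      \<le> 2 * (\<integral>t. g t \<partial>lborel)" if T: "T \<ge> 0" for T :: real
  proof -
    have "(CLBINT t=-T..T. F t * char \<mu> t) - (CLBINT t=-T..T. F t * char \<nu> t)
        = (CLBINT t:{-T<..<T}. F t * char \<mu> t - F t * char \<nu> t)"
      using T by (simp add: interval_lebesgue_integral_def int assms set_integral_diff)
    also have "cmod \<dots> \<le> (\<integral>t. 2 * g t \<partial>lborel)"
      unfolding set_lebesgue_integral_def
    proof (rule Bochner_Integration.integral_norm_bound_integral)
      show "integrable lborel (\<lambda>t. indicat_real {-T<..<T} t *\<^sub>R (F t * char \<mu> t - F t * char \<nu> t))"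
        using set_integral_diff(1)[OF int[OF \<mu>] int[OF \<nu>]] by (simp add: set_integrable_def)
      show "integrable lborel (\<lambda>t. 2 * g t)" using g by simp
      fix t :: real
      have "cmod (F t * (char \<mu> t - char \<nu> t)) \<le> 2 * g t"
      proof (cases "t = 0")
        case False
        have "cmod (F t * (char \<mu> t - char \<nu> t)) \<le> 2 / \<bar>t\<bar> * (\<bar>t\<bar> * g t)"
          unfolding norm_mult by (intro mult_mono F_le2 le) auto
        with False show ?thesis by simp
      qed (use g in \<open>simp add: F_def\<close>)
      then show "cmod (indicat_real {-T<..<T} t *\<^sub>R (F t * char \<mu> t - F t * char \<nu> t)) \<le> 2 * g t"
        using g(2)[of t] by (auto split: split_indicator simp: algebra_simps)
    qed
    finally show ?thesis by simp
  qed
  have "(\<lambda>n. 1 / (2 * pi) * (CLBINT t=-real n..real n. F t * char \<mu> t)) \<longlonglongrightarrow> of_real (measure \<mu> {a<..b})"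
    unfolding F_def
    using \<mu>.Levy_Inversion[OF ab atoms(1,2)] by simp
  moreover have "(\<lambda>n. 1 / (2 * pi) * (CLBINT t=-real n..real n. F t * char \<nu> t)) \<longlonglongrightarrow> of_real (measure \<nu> {a<..b})"
    unfolding F_def
    using \<nu>.Levy_Inversion[OF ab atoms(3,4)] by simp
  ultimately have "(\<lambda>n. cmod (1 / (2 * pi) * (CLBINT t=-real n..real n. F t * char \<mu> t)
      - 1 / (2 * pi) * (CLBINT t=-real n..real n. F t * char \<nu> t)))
      \<longlonglongrightarrow> cmod (of_real (measure \<mu> {a<..b}) - of_real (measure \<nu> {a<..b}))"
    by (intro tendsto_norm tendsto_diff)
  then have "cmod (of_real (measure \<mu> {a<..b}) - of_real (measure \<nu> {a<..b})) \<le> (\<integral>t. g t \<partial>lborel) / pi"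
  proof (rule LIMSEQ_le_const2, intro exI[of _ 0] allI impI)
    fix n :: nat
    have "cmod (1 / (2 * pi) * (CLBINT t=-real n..real n. F t * char \<mu> t)
      - 1 / (2 * pi) * (CLBINT t=-real n..real n. F t * char \<nu> t))
      = 1 / (2 * pi) * cmod ((CLBINT t=-real n..real n. F t * char \<mu> t)
      - (CLBINT t=-real n..real n. F t * char \<nu> t))"
      unfolding right_diff_distrib[symmetric] norm_mult by (simp add: norm_divide)
    also have "\<dots> \<le> 1 / (2 * pi) * (2 * (\<integral>t. g t \<partial>lborel))"
      by (intro mult_left_mono *) auto
    finally show "cmod (1 / (2 * pi) * (CLBINT t=-real n..real n. F t * char \<mu> t)
      - 1 / (2 * pi) * (CLBINT t=-real n..real n. F t * char \<nu> t)) \<le> (\<integral>t. g t \<partial>lborel) / pi"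
      by simp
  qed
  then show ?thesis
    by (simp flip: of_real_diff)
qed

text \<open>The inversion bound is uniform in the left endpoint, which can therefore be sent to
  minus infinity.\<close>

lemma cdf_diff_le_char_diff:
  fixes \<mu> \<nu> :: "real measure" and g :: "real \<Rightarrow> real"
  assumes \<mu>: "real_distribution \<mu>" and \<nu>: "real_distribution \<nu>"
    and atoms: "\<And>x. measure \<mu> {x} = 0" "\<And>x. measure \<nu> {x} = 0"
    and g: "integrable lborel g" "\<And>t. 0 \<le> g t"
    and le: "\<And>t. cmod (char \<mu> t - char \<nu> t) \<le> \<bar>t\<bar> * g t"
  shows "\<bar>cdf \<mu> x - cdf \<nu> x\<bar> \<le> (\<integral>t. g t \<partial>lborel) / pi"
proof -
  interpret \<mu>: real_distribution \<mu> by fact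
  interpret \<nu>: real_distribution \<nu> by fact
  have "((\<lambda>a. \<bar>(cdf \<mu> x - cdf \<mu> a) - (cdf \<nu> x - cdf \<nu> a)\<bar>) \<longlongrightarrow> \<bar>(cdf \<mu> x - 0) - (cdf \<nu> x - 0)\<bar>) at_bot"
    by (intro tendsto_intros \<mu>.cdf_lim_at_bot \<nu>.cdf_lim_at_bot)
  moreover have "\<forall>\<^sub>F a in at_bot. \<bar>(cdf \<mu> x - cdf \<mu> a) - (cdf \<nu> x - cdf \<nu> a)\<bar> \<le> (\<integral>t. g t \<partial>lborel) / pi"
    using eventually_le_at_bot[of "x - 1"]
  proof eventually_elim
    case (elim a)
    then have "a < x" by simp
    then show ?case
      using Levy_Inversion_diff[OF \<mu> \<nu> _ atoms(1) atoms(1) atoms(2) atoms(2) g le, of a x]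
      by (simp add: \<mu>.cdf_diff_eq \<nu>.cdf_diff_eq)
  qed
  ultimately have "\<bar>(cdf \<mu> x - 0) - (cdf \<nu> x - 0)\<bar> \<le> (\<integral>t. g t \<partial>lborel) / pi"
    by (rule tendsto_upperbound) simp
  then show ?thesis by simp
qed

text \<open>The convolution of \<mu> with a centred normal law of standard deviation \<eta>,
  realised on a product space so that the smoothed and the original variable can be compared outcome
  by outcome.\<close>

definition gauss_smooth :: "real measure \<Rightarrow> real \<Rightarrow> real measure" where
  "gauss_smooth \<mu> \<eta> = distr (\<mu> \<Otimes>\<^sub>M std_normal_distribution) borel (\<lambda>z. fst z + \<eta> * snd z)"

context
  fixes \<mu> :: "real measure" and \<eta> :: real
  assumes \<mu>: "real_distribution \<mu>" and \<eta>: "\<eta> > 0"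
begin

interpretation \<mu>: real_distribution \<mu> by (rule \<mu>)
interpretation N: real_distribution std_normal_distribution by (rule real_dist_normal_dist)
interpretation P: pair_prob_space \<mu> std_normal_distribution ..

lemma real_distribution_gauss_smooth: "real_distribution (gauss_smooth \<mu> \<eta>)"
  unfolding gauss_smooth_def by (rule P.real_distribution_distr) measurable

lemma char_gauss_smooth: "char (gauss_smooth \<mu> \<eta>) t = char \<mu> t * exp (- (\<eta>\<^sup>2 * t\<^sup>2) / 2)"
proof -
  have "char (gauss_smooth \<mu> \<eta>) t =
      (CLINT z | \<mu> \<Otimes>\<^sub>M std_normal_distribution. iexp (t * (fst z + \<eta> * snd z)))"
    unfolding gauss_smooth_def char_def by (subst integral_distr) simp_all
  also have "\<dots> = (CLINT x|\<mu>. CLINT y|std_normal_distribution. iexp (t * (fst (x, y) + \<eta> * snd (x, y))))"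
    by (rule P.integral_fst'[symmetric]) (rule P.integrable_const_bound[where B=1], auto)
  also have "\<dots> = (CLINT x|\<mu>. CLINT y|std_normal_distribution. iexp (t * x) * iexp ((\<eta> * t) * y))"
    by (simp add: algebra_simps exp_add)
  also have "\<dots> = (CLINT x|\<mu>. iexp (t * x)) * char std_normal_distribution (\<eta> * t)"
    by (simp add: char_def)
  finally show ?thesis
    by (simp add: char_def[of \<mu>] char_std_normal_distribution power_mult_distrib)
qed

text \<open>For a fixed first coordinate, hitting \<open>x\<close> pins the Gaussian coordinate to
  one point. Levy inversion thus applies at every endpoint, even if \<mu> has atoms.\<close>

lemma measure_gauss_smooth_singleton: "measure (gauss_smooth \<mu> \<eta>) {x} = 0"
proof -
  have "AE z in \<mu> \<Otimes>\<^sub>M std_normal_distribution. fst z + \<eta> * snd z \<noteq> x"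
  proof (rule P.AE_pair_measure)
    show "AE u in \<mu>. AE v in std_normal_distribution. fst (u, v) + \<eta> * snd (u, v) \<noteq> x"
    proof (rule AE_I2)
      fix u
      have "AE v in lborel. v \<noteq> (x - u) / \<eta>"
        by (rule AE_lborel_singleton)
      then show "AE v in std_normal_distribution. fst (u, v) + \<eta> * snd (u, v) \<noteq> x"
        using \<eta> by (subst AE_density) (auto elim!: eventually_mono simp: field_simps)
    qed
  qed measurable
  then have "P.prob {z \<in> space (\<mu> \<Otimes>\<^sub>M std_normal_distribution). fst z + \<eta> * snd z = x} = 0"
    by (subst P.prob_Collect_eq_0) measurable
  then show ?thesis
    unfolding gauss_smooth_def
    by (subst measure_distr) (auto simp: vimage_def Int_def conj_commute space_pair_measure)
qed

text \<open>Chebyshev with unit variance; a polynomial tail suffices because only the order n powr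
  (- 1/4) is sought.\<close>

lemma gauss_smooth_deviation:
  assumes "L > 0"
  shows "P.prob {z \<in> space (\<mu> \<Otimes>\<^sub>M std_normal_distribution). L \<le> \<bar>snd z\<bar>} \<le> 1 / L\<^sup>2"
proof -
  have 1: "N.expectation (\<lambda>x. x) = 0" "N.expectation (\<lambda>x. x\<^sup>2) = 1"
    using integral_std_normal_distribution_moment_odd[of 1] std_normal_distribution_even_moments(1)[of 1]
    by (simp_all add: fact_numeral)
  have "P.prob {z \<in> space (\<mu> \<Otimes>\<^sub>M std_normal_distribution). L \<le> \<bar>snd z\<bar>}
      = P.prob (UNIV \<times> {z. L \<le> \<bar>z\<bar>})"
    by (rule arg_cong[where f=P.prob]) (auto simp: space_pair_measure)
  also have "\<dots> = N.prob {z. L \<le> \<bar>z\<bar>}"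
    by (simp add: measure_def N.emeasure_pair_measure_Times \<mu>.emeasure_space_1[simplified])
  also have "\<dots> \<le> 1 / L\<^sup>2"
    using N.Chebyshev_inequality[of "\<lambda>x. x" L] integrable_std_normal_distribution_moment[of 2] assms
    by (simp add: 1)
  finally show ?thesis .
qed

lemma cdf_eq_prob_pair: "cdf \<mu> x = P.prob {z \<in> space (\<mu> \<Otimes>\<^sub>M std_normal_distribution). fst z \<le> x}"
proof -
  have "P.prob {z \<in> space (\<mu> \<Otimes>\<^sub>M std_normal_distribution). fst z \<le> x} = P.prob ({..x} \<times> UNIV)"
    by (rule arg_cong[where f=P.prob]) (auto simp: space_pair_measure)
  then show ?thesis
    by (simp add: measure_def N.emeasure_pair_measure_Times N.emeasure_space_1[simplified] cdf_def)
qed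

lemma cdf_gauss_smooth_eq_prob: "cdf (gauss_smooth \<mu> \<eta>) x =
    P.prob {z \<in> space (\<mu> \<Otimes>\<^sub>M std_normal_distribution). fst z + \<eta> * snd z \<le> x}"
  unfolding gauss_smooth_def cdf_def
  by (subst measure_distr) (auto intro!: arg_cong[where f=P.prob])

text \<open>Unless the Gaussian coordinate reaches \<open>L\<close> in absolute value, the two
  variables differ by at most \<open>\<eta> * L\<close>.\<close>

lemma cdf_le_gauss_smooth:
  assumes "L > 0"
  shows "cdf \<mu> x \<le> cdf (gauss_smooth \<mu> \<eta>) (x + \<eta> * L) + 1 / L\<^sup>2"
proof -
  let ?S = "space (\<mu> \<Otimes>\<^sub>M std_normal_distribution)"
  have "cdf \<mu> x \<le> P.prob ({z \<in> ?S. fst z + \<eta> * snd z \<le> x + \<eta> * L} \<union> {z \<in> ?S. L \<le> \<bar>snd z\<bar>})"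
    unfolding cdf_eq_prob_pair
  proof (rule P.finite_measure_mono)
    show "{z \<in> ?S. fst z \<le> x}
      \<subseteq> {z \<in> ?S. fst z + \<eta> * snd z \<le> x + \<eta> * L} \<union> {z \<in> ?S. L \<le> \<bar>snd z\<bar>}"
    proof safe
      fix u v assume *: "fst (u, v) \<le> x" "\<not> L \<le> \<bar>snd (u, v)\<bar>"
      then have "\<eta> * v \<le> \<eta> * L" using \<eta> by (intro mult_left_mono) auto
      with * show "fst (u, v) + \<eta> * snd (u, v) \<le> x + \<eta> * L" by simp
    qed
  qed measurable
  also have "\<dots> \<le> P.prob {z \<in> ?S. fst z + \<eta> * snd z \<le> x + \<eta> * L} + P.prob {z \<in> ?S. L \<le> \<bar>snd z\<bar>}"
    by (rule measure_Un_le) measurable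
  finally show ?thesis
    using gauss_smooth_deviation[OF assms] by (simp add: cdf_gauss_smooth_eq_prob)
qed

lemma gauss_smooth_le_cdf:
  assumes "L > 0"
  shows "cdf (gauss_smooth \<mu> \<eta>) x \<le> cdf \<mu> (x + \<eta> * L) + 1 / L\<^sup>2"
proof -
  let ?S = "space (\<mu> \<Otimes>\<^sub>M std_normal_distribution)"
  have "cdf (gauss_smooth \<mu> \<eta>) x \<le> P.prob ({z \<in> ?S. fst z \<le> x + \<eta> * L} \<union> {z \<in> ?S. L \<le> \<bar>snd z\<bar>})"
    unfolding cdf_gauss_smooth_eq_prob
  proof (rule P.finite_measure_mono)
    show "{z \<in> ?S. fst z + \<eta> * snd z \<le> x}
      \<subseteq> {z \<in> ?S. fst z \<le> x + \<eta> * L} \<union> {z \<in> ?S. L \<le> \<bar>snd z\<bar>}"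
    proof safe
      fix u v assume *: "fst (u, v) + \<eta> * snd (u, v) \<le> x" "\<not> L \<le> \<bar>snd (u, v)\<bar>"
      then have "\<eta> * (-v) \<le> \<eta> * L" using \<eta> by (intro mult_left_mono) auto
      with * show "fst (u, v) \<le> x + \<eta> * L" by simp
    qed
  qed measurable
  also have "\<dots> \<le> P.prob {z \<in> ?S. fst z \<le> x + \<eta> * L} + P.prob {z \<in> ?S. L \<le> \<bar>snd z\<bar>}"
    by (rule measure_Un_le) measurable
  finally show ?thesis
    using gauss_smooth_deviation[OF assms] by (simp add: cdf_eq_prob_pair)
qed

end

lemma cdf_std_normal_Lipschitz:
  assumes "x \<le> y"
  shows "cdf std_normal_distribution y - cdf std_normal_distribution x \<le> y - x"
proof -
  interpret N: real_distribution std_normal_distribution by (rule real_dist_normal_dist)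
  have "std_normal_density t \<le> 1" for t
  proof -
    have "1 \<le> sqrt (2 * pi)" using pi_gt3 by simp
    then show ?thesis unfolding std_normal_density_def
      by (intro mult_le_one) (auto simp: divide_le_eq)
  qed
  then have "emeasure std_normal_distribution {x<..y} \<le> (\<integral>\<^sup>+t. indicator {x<..y} t \<partial>lborel)"
    by (subst emeasure_density)
      (auto simp del: nn_integral_indicator intro!: nn_integral_mono split: split_indicator)
  also have "\<dots> = ennreal (y - x)" using assms by simp
  finally have "measure std_normal_distribution {x<..y} \<le> y - x"
    using assms by (simp add: N.emeasure_eq_measure)
  then show ?thesis
    using assms by (cases "x = y") (auto simp: N.cdf_diff_eq)
qed

text \<open>Convolving both measures with \<open>N(0,\<eta>\<^sup>2)\<close> makes the right-hand side of the inversion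
  formula absolutely convergent; undoing the convolution costs \<open>2 \<eta> L + 2 / L\<^sup>2\<close>.\<close>

lemma smoothing_inequality:
  fixes \<mu> :: "real measure" and g :: "real \<Rightarrow> real"
  assumes \<mu>: "real_distribution \<mu>" and \<eta>: "\<eta> > 0" and L: "L > 0"
    and g: "integrable lborel g" "\<And>t. 0 \<le> g t"
    and le: "\<And>t. cmod (char \<mu> t - exp (- t\<^sup>2 / 2)) * exp (- (\<eta>\<^sup>2 * t\<^sup>2) / 2) \<le> \<bar>t\<bar> * g t"
  shows "\<bar>cdf \<mu> x - cdf std_normal_distribution x\<bar>
    \<le> (\<integral>t. g t \<partial>lborel) / pi + 2 * \<eta> * L + 2 / L\<^sup>2"
proof -
  let ?N = std_normal_distribution
  note N = real_dist_normal_dist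
  have "cmod (char (gauss_smooth \<mu> \<eta>) t - char (gauss_smooth ?N \<eta>) t) \<le> \<bar>t\<bar> * g t" for t
    using le[of t]
    unfolding char_gauss_smooth[OF \<mu> \<eta>] char_gauss_smooth[OF N \<eta>] left_diff_distrib[symmetric]
    by (simp add: char_std_normal_distribution norm_mult)
  then have D: "\<bar>cdf (gauss_smooth \<mu> \<eta>) y - cdf (gauss_smooth ?N \<eta>) y\<bar> \<le> (\<integral>t. g t \<partial>lborel) / pi" for y
    by (intro cdf_diff_le_char_diff g real_distribution_gauss_smooth \<mu> N \<eta>
        measure_gauss_smooth_singleton)
  \<comment> \<open>The argument moves twice, once to smooth \<mu> and once to unsmooth the normal
    law; it is moved back on the normal side, where the distribution function is Lipschitz.\<close>
  have "cdf \<mu> x \<le> cdf (gauss_smooth \<mu> \<eta>) (x + \<eta> * L) + 1 / L\<^sup>2"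
    by (rule cdf_le_gauss_smooth[OF \<mu> \<eta> L])
  also have "\<dots> \<le> cdf ?N (x + \<eta> * L + \<eta> * L) + 2 / L\<^sup>2 + (\<integral>t. g t \<partial>lborel) / pi"
    using gauss_smooth_le_cdf[OF N \<eta> L, of "x + \<eta> * L"] D[of "x + \<eta> * L"] by simp
  also have "\<dots> \<le> cdf ?N x + 2 * \<eta> * L + 2 / L\<^sup>2 + (\<integral>t. g t \<partial>lborel) / pi"
    using cdf_std_normal_Lipschitz[of x "x + \<eta> * L + \<eta> * L"] \<eta> L by (simp add: algebra_simps)
  finally have 1: "cdf \<mu> x - cdf ?N x \<le> (\<integral>t. g t \<partial>lborel) / pi + 2 * \<eta> * L + 2 / L\<^sup>2"
    by simp
  have "cdf ?N x \<le> cdf ?N (x - \<eta> * L - \<eta> * L) + 2 * \<eta> * L"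
    using cdf_std_normal_Lipschitz[of "x - \<eta> * L - \<eta> * L" x] \<eta> L by (simp add: algebra_simps)
  also have "\<dots> \<le> cdf (gauss_smooth ?N \<eta>) (x - \<eta> * L) + 1 / L\<^sup>2 + 2 * \<eta> * L"
    using cdf_le_gauss_smooth[OF N \<eta> L, of "x - \<eta> * L - \<eta> * L"] by (simp add: algebra_simps)
  also have "\<dots> \<le> cdf \<mu> x + (\<integral>t. g t \<partial>lborel) / pi + 2 * \<eta> * L + 2 / L\<^sup>2"
    using gauss_smooth_le_cdf[OF \<mu> \<eta> L, of "x - \<eta> * L"] D[of "x - \<eta> * L"] by simp
  finally show ?thesis using 1 by simp
qed

section \<open>The Berry--Esseen theorem for moments of order 2 + \<delta>\<close>

text \<open>Rescaling by \<theta> reduces this to the unit disc. The factor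
  \<open>\<theta> ^ (n - 1)\<close> later supplies Gaussian decay in the frequency.\<close>

lemma norm_power_diff_le:
  fixes z w :: complex
  assumes "cmod z \<le> \<theta>" "cmod w \<le> \<theta>" "0 < \<theta>" "n \<ge> 1"
  shows "cmod (z ^ n - w ^ n) \<le> real n * cmod (z - w) * \<theta> ^ (n - 1)"
proof -
  have "cmod ((z / \<theta>) ^ n - (w / \<theta>) ^ n) \<le> real n * cmod (z / \<theta> - w / \<theta>)"
    using assms by (intro norm_power_diff) (auto simp: norm_divide divide_le_eq)
  then have "cmod (z ^ n - w ^ n) / \<theta> ^ n \<le> real n * cmod (z - w) / \<theta>"
    using assms by (simp add: power_divide norm_divide norm_power flip: diff_divide_distrib)
  moreover have "\<theta> ^ n = \<theta> * \<theta> ^ (n - 1)"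
    using assms by (metis One_nat_def Suc_pred power_Suc zero_less_one order_less_le_trans)
  ultimately show ?thesis
    using assms by (simp add: field_simps)
qed

lemma exp_minus_approx:
  fixes y :: real
  assumes "y \<ge> 0"
  shows "\<bar>exp (- y) - (1 - y)\<bar> \<le> y\<^sup>2 / 2"
proof -
  have "1 - y \<le> exp (- y)" using exp_ge_add_one_self[of "- y"] by simp
  moreover have "exp (- y) \<le> 1 - y + y\<^sup>2 / 2"
  proof -
    obtain t where "exp (- y) = (\<Sum>m<3. (- y) ^ m / fact m) + exp t / fact 3 * (- y) ^ 3"
      using Maclaurin_exp_le[of "- y" 3] by blast
    moreover have "exp t / fact 3 * (- y) ^ 3 \<le> 0"
      using assms by (simp add: mult_nonneg_nonpos)
    ultimately show ?thesis by (simp add: eval_nat_numeral)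
  qed
  ultimately show ?thesis by simp
qed

text \<open>Turns the Gaussian kernel into a negative sixth power of the frequency, enough for both
  integrability and a gain in n.\<close>

lemma exp_minus_le_cube:
  fixes u :: real
  assumes "u > 0"
  shows "exp (- u) \<le> 6 / u ^ 3"
proof -
  obtain t where "exp u = (\<Sum>m<4. u ^ m / fact m) + exp t / fact 4 * u ^ 4"
    using Maclaurin_exp_le[of u 4] by blast
  moreover have "0 \<le> exp t / fact 4 * u ^ 4" "0 \<le> 1 + u + u\<^sup>2 / 2"
    using assms by simp_all
  moreover have "(\<Sum>m<4. u ^ m / fact m) = 1 + u + u\<^sup>2 / 2 + u ^ 3 / 6"
    by (simp add: eval_nat_numeral)
  ultimately have "u ^ 3 / 6 \<le> exp u" by linarith
  then show ?thesis using assms by (simp add: exp_minus field_simps)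
qed

lemma sqrt_powr:
  fixes x :: real
  assumes "x \<ge> 0"
  shows "sqrt x powr a = x powr (a / 2)"
  unfolding powr_half_sqrt[OF assms, symmetric] powr_powr by simp

lemma power2_le_powr:
  fixes x :: real
  assumes "\<delta> \<ge> 0"
  shows "x\<^sup>2 \<le> 1 + \<bar>x\<bar> powr (2 + \<delta>)"
proof (cases "\<bar>x\<bar> \<le> 1")
  case True
  then have "x\<^sup>2 \<le> 1" by (simp add: abs_square_le_1)
  then show ?thesis by (simp add: add_increasing2)
next
  case False
  then have "\<bar>x\<bar> powr 2 \<le> \<bar>x\<bar> powr (2 + \<delta>)" using assms by (intro powr_mono) auto
  then show ?thesis using False by (simp add: powr_numeral)
qed

section \<open>Characteristic functions under moments of order 2 + \<delta>\<close>

context prob_space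
begin

lemma integrable_powr_imp_square:
  fixes Y :: "'a \<Rightarrow> real" and \<delta> :: real
  assumes [measurable]: "random_variable borel Y" and "integrable M (\<lambda>w. \<bar>Y w\<bar> powr (2 + \<delta>))" "\<delta> \<ge> 0"
  shows "integrable M (\<lambda>w. (Y w)\<^sup>2)" "integrable M Y"
proof -
  show "integrable M (\<lambda>w. (Y w)\<^sup>2)"
    by (rule Bochner_Integration.integrable_bound[of M "\<lambda>w. 1 + \<bar>Y w\<bar> powr (2 + \<delta>)"])
      (use assms power2_le_powr in auto)
  then show "integrable M Y"
    by (rule square_integrable_imp_integrable[rotated]) simp
qed

text \<open>The Taylor remainder is a minimum of a quadratic and a cubic expression. With u =
  \<open>\<bar>s\<bar> * \<bar>Y x\<bar>\<close>, the inequalities u \<le> u powr \<delta> for u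
  \<le> 1 and 1 \<le> u powr \<delta> for u > 1 interpolate between them.\<close>

lemma char_le_powr:
  assumes [measurable]: "random_variable borel Y"
    and int: "integrable M (\<lambda>w. \<bar>Y w\<bar> powr (2 + \<delta>))" and \<delta>: "0 < \<delta>" "\<delta> \<le> 1"
    and mean: "expectation Y = 0" and var: "expectation (\<lambda>w. (Y w)\<^sup>2) = 1"
  defines "\<beta> \<equiv> expectation (\<lambda>w. \<bar>Y w\<bar> powr (2 + \<delta>))"
  shows "cmod (char (distr M borel Y) s - (1 - s\<^sup>2 / 2)) \<le> \<beta> * \<bar>s\<bar> powr (2 + \<delta>)"
proof -
  note int2 = integrable_powr_imp_square[OF assms(1) int less_imp_le[OF \<delta>(1)]]
  have "cmod (char (distr M borel Y) s - (1 - s\<^sup>2 * 1 / 2))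
      \<le> s\<^sup>2 / 6 * expectation (\<lambda>x. min (6 * (Y x)\<^sup>2) (\<bar>s\<bar> * \<bar>Y x\<bar> ^ 3))"
    by (rule char_approx3') (use int2 mean var in simp_all)
  also have "\<dots> \<le> s\<^sup>2 / 6 * expectation (\<lambda>x. 6 * \<bar>s\<bar> powr \<delta> * \<bar>Y x\<bar> powr (2 + \<delta>))"
  proof (intro mult_left_mono integral_mono)
    show "integrable M (\<lambda>x. min (6 * (Y x)\<^sup>2) (\<bar>s\<bar> * \<bar>Y x\<bar> ^ 3))"
      by (rule Bochner_Integration.integrable_bound[of M "\<lambda>x. 6 * (Y x)\<^sup>2"]) (use int2 in auto)
    show "integrable M (\<lambda>x. 6 * \<bar>s\<bar> powr \<delta> * \<bar>Y x\<bar> powr (2 + \<delta>))"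
      using int by simp
    fix x
    let ?y = "\<bar>Y x\<bar>"
    show "min (6 * (Y x)\<^sup>2) (\<bar>s\<bar> * ?y ^ 3) \<le> 6 * \<bar>s\<bar> powr \<delta> * ?y powr (2 + \<delta>)"
    proof (cases "s = 0 \<or> Y x = 0")
      case False
      have eq: "\<bar>s\<bar> powr \<delta> * ?y powr (2 + \<delta>) = (Y x)\<^sup>2 * (\<bar>s\<bar> * ?y) powr \<delta>"
        using False by (simp add: powr_add powr_mult powr_numeral)
      show ?thesis
      proof (cases "\<bar>s\<bar> * ?y \<le> 1")
        case True
        have "\<bar>s\<bar> * ?y \<le> (\<bar>s\<bar> * ?y) powr \<delta>"
          using powr_mono'[of \<delta> 1 "\<bar>s\<bar> * ?y"] True \<delta> by simp
        then have "(Y x)\<^sup>2 * (\<bar>s\<bar> * ?y) \<le> (Y x)\<^sup>2 * (\<bar>s\<bar> * ?y) powr \<delta>"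
          by (intro mult_left_mono) auto
        moreover have "(Y x)\<^sup>2 * (\<bar>s\<bar> * ?y) = \<bar>s\<bar> * ?y ^ 3"
          unfolding power2_abs[of "Y x", symmetric] by (simp only: power2_eq_square power3_eq_cube ac_simps)
        moreover have "0 \<le> (Y x)\<^sup>2 * (\<bar>s\<bar> * ?y) powr \<delta>" by simp
        ultimately show ?thesis unfolding mult.assoc eq by linarith
      next
        case False
        then have "1 \<le> (\<bar>s\<bar> * ?y) powr \<delta>"
          using \<delta> by (intro ge_one_powr_ge_zero) auto
        then have "(Y x)\<^sup>2 * 1 \<le> (Y x)\<^sup>2 * (\<bar>s\<bar> * ?y) powr \<delta>"
          by (intro mult_left_mono) auto
        then show ?thesis unfolding mult.assoc eq by linarith
      qed
    qed auto
  qed auto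
  also have "\<dots> = \<beta> * (s\<^sup>2 * \<bar>s\<bar> powr \<delta>)"
    by (simp add: \<beta>_def)
  also have "s\<^sup>2 * \<bar>s\<bar> powr \<delta> = \<bar>s\<bar> powr (2 + \<delta>)"
    by (cases "s = 0") (simp_all add: powr_add powr_numeral)
  finally show ?thesis by simp
qed

text \<open>With s = t / sqrt n, the smallness condition lets the error consume at most half of
  s^2/2, so both bases of the n-th powers are at most exp (- s^2/4).\<close>

lemma char_power_diff_le:
  fixes n :: nat
  assumes [measurable]: "random_variable borel Y"
    and int: "integrable M (\<lambda>w. \<bar>Y w\<bar> powr (2 + \<delta>))" and \<delta>: "0 < \<delta>" "\<delta> \<le> 1"
    and mean: "expectation Y = 0" and var: "expectation (\<lambda>w. (Y w)\<^sup>2) = 1"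
  defines "\<beta> \<equiv> expectation (\<lambda>w. \<bar>Y w\<bar> powr (2 + \<delta>))"
  assumes n: "n \<ge> 2" and t: "\<bar>t\<bar> \<le> sqrt n" "\<beta> * (\<bar>t\<bar> / sqrt n) powr \<delta> \<le> 1 / 4"
  shows "cmod (char (distr M borel Y) (t / sqrt n) ^ n - complex_of_real (exp (- t\<^sup>2 / 2)))
    \<le> (\<beta> + 1) * n powr (- \<delta> / 2) * \<bar>t\<bar> powr (2 + \<delta>) * exp (- t\<^sup>2 / 8)"
proof -
  define s where "s = t / sqrt n"
  have s1: "\<bar>s\<bar> \<le> 1" using t n by (simp add: s_def)
  have s2: "n * s\<^sup>2 = t\<^sup>2" using n by (simp add: s_def power_divide)
  have s0: "s\<^sup>2 * \<bar>s\<bar> powr \<delta> = \<bar>s\<bar> powr (2 + \<delta>)"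
    by (cases "s = 0") (simp_all add: powr_add powr_numeral)
  have \<beta>0: "\<beta> \<ge> 0" by (simp add: \<beta>_def)
  let ?z = "char (distr M borel Y) s" and ?w = "complex_of_real (exp (- s\<^sup>2 / 2))"
  let ?\<theta> = "exp (- s\<^sup>2 / 4)"
  have z: "cmod (?z - (1 - s\<^sup>2 / 2)) \<le> \<beta> * \<bar>s\<bar> powr (2 + \<delta>)"
    unfolding \<beta>_def by (rule char_le_powr) fact+
  have "\<bar>exp (- (s\<^sup>2 / 2)) - (1 - s\<^sup>2 / 2)\<bar> \<le> (s\<^sup>2 / 2)\<^sup>2 / 2"
    by (rule exp_minus_approx) simp
  also have "\<dots> \<le> s\<^sup>2 * \<bar>s\<bar> powr \<delta>"
  proof -
    have "\<bar>s\<bar> * \<bar>s\<bar> \<le> 1 * \<bar>s\<bar> powr \<delta>"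
      using s1 powr_mono'[of \<delta> 1 "\<bar>s\<bar>"] \<delta> by (intro mult_mono) auto
    then have "s\<^sup>2 * (s\<^sup>2) \<le> s\<^sup>2 * \<bar>s\<bar> powr \<delta>"
      by (intro mult_left_mono) (auto simp: power2_eq_square)
    moreover have "(q / 2)\<^sup>2 / 2 \<le> q * q" for q :: real
      by (simp add: power2_eq_square)
    from this[of "s\<^sup>2"] have "(s\<^sup>2 / 2)\<^sup>2 / 2 \<le> s\<^sup>2 * s\<^sup>2" .
    ultimately show ?thesis by linarith
  qed
  finally have w: "cmod (?w - (1 - s\<^sup>2 / 2)) \<le> \<bar>s\<bar> powr (2 + \<delta>)"
    unfolding s0 of_real_diff[symmetric] norm_of_real by simp
  have zw: "cmod (?z - ?w) \<le> (\<beta> + 1) * \<bar>s\<bar> powr (2 + \<delta>)"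
    using norm_triangle_ineq4[of "?z - (1 - s\<^sup>2 / 2)" "?w - (1 - s\<^sup>2 / 2)"] z w
    by (simp add: algebra_simps)
  have "cmod ?z \<le> cmod (complex_of_real (1 - s\<^sup>2 / 2)) + \<beta> * \<bar>s\<bar> powr (2 + \<delta>)"
    using norm_triangle_sub[of ?z "complex_of_real (1 - s\<^sup>2 / 2)"] z by simp
  also have "cmod (complex_of_real (1 - s\<^sup>2 / 2)) = 1 - s\<^sup>2 / 2"
    using s1 abs_square_le_1[of s] unfolding norm_of_real by linarith
  also have "\<beta> * \<bar>s\<bar> powr (2 + \<delta>) = (\<beta> * \<bar>s\<bar> powr \<delta>) * s\<^sup>2"
    unfolding s0[symmetric] by simp
  also have "\<dots> \<le> 1 / 4 * s\<^sup>2"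
    using t(2) n by (intro mult_right_mono) (simp_all add: s_def)
  also have "1 - s\<^sup>2 / 2 + 1 / 4 * s\<^sup>2 \<le> ?\<theta>"
    using exp_ge_add_one_self[of "- s\<^sup>2 / 4"] by simp
  finally have z\<theta>: "cmod ?z \<le> ?\<theta>" by simp
  have w\<theta>: "cmod ?w \<le> ?\<theta>" by (simp only: norm_of_real) simp
  have "cmod (?z ^ n - ?w ^ n) \<le> real n * cmod (?z - ?w) * ?\<theta> ^ (n - 1)"
    using n by (intro norm_power_diff_le z\<theta> w\<theta>) auto
  also have "\<dots> \<le> real n * ((\<beta> + 1) * \<bar>s\<bar> powr (2 + \<delta>)) * exp (- t\<^sup>2 / 8)"
  proof (intro mult_mono zw mult_left_mono)
    have "?\<theta> ^ (n - 1) = exp (- (real n - 1) * s\<^sup>2 / 4)"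
      using n unfolding exp_of_nat_mult[symmetric] by (simp add: of_nat_diff field_simps)
    also have "\<dots> \<le> exp (- t\<^sup>2 / 8)"
    proof -
      \<comment> \<open>Here n \<ge> 2 gives n - 1 \<ge> n/2; this second halving produces the 8 in
        the exponent.\<close>
      have "real n / 2 * s\<^sup>2 \<le> (real n - 1) * s\<^sup>2" using n by (intro mult_right_mono) auto
      then show ?thesis unfolding s2[symmetric] by (simp add: left_diff_distrib)
    qed
    finally show "?\<theta> ^ (n - 1) \<le> exp (- t\<^sup>2 / 8)" .
  qed (use \<beta>0 in auto)
  also have "real n * ((\<beta> + 1) * \<bar>s\<bar> powr (2 + \<delta>)) = (\<beta> + 1) * n powr (- \<delta> / 2) * \<bar>t\<bar> powr (2 + \<delta>)"
  proof -
    have "real n * \<bar>s\<bar> powr (2 + \<delta>) = n * \<bar>t\<bar> powr (2 + \<delta>) / (sqrt n powr (2 + \<delta>))"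
      using n by (simp add: s_def powr_divide)
    also have "sqrt n powr (2 + \<delta>) = real n powr (1 + \<delta> / 2)"
      by (simp add: sqrt_powr add_divide_distrib)
    also have "n * \<bar>t\<bar> powr (2 + \<delta>) / real n powr (1 + \<delta> / 2) = n powr (- \<delta> / 2) * \<bar>t\<bar> powr (2 + \<delta>)"
    proof -
      have "real n powr (1 + \<delta> / 2) = n * n powr (\<delta> / 2)"
        using n powr_add[of "real n" 1 "\<delta> / 2"] by simp
      then show ?thesis using n by (simp add: powr_minus field_simps)
    qed
    finally show ?thesis by simp
  qed
  also have "?w ^ n = complex_of_real (exp (- t\<^sup>2 / 2))"
  proof -
    have "exp (- s\<^sup>2 / 2) ^ n = exp (real n * (- s\<^sup>2 / 2))"
      by (rule exp_of_nat_mult[symmetric])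
    also have "real n * (- s\<^sup>2 / 2) = - t\<^sup>2 / 2"
      using s2 by simp
    finally show ?thesis by (simp only: of_real_power[symmetric])
  qed
  finally show ?thesis by (simp add: s_def)
qed

end

lemma integrable_one_over_1_plus_square: "integrable lborel (\<lambda>t::real. 1 / (1 + t\<^sup>2))"
  using integrable_inverse_1_plus_square 
  by (simp add: set_integrable_def einterval_def inverse_eq_divide)

lemma integrable_exp_times_quadratic: "integrable lborel (\<lambda>t::real. exp (- t\<^sup>2 / 8) * (1 + t\<^sup>2))"
proof -
  \<comment> \<open>Up to a constant, exp (- t^2/8) is the normal density of standard deviation 2,
    whose moments of order 0 and 2 are finite.\<close>
  have eq: "sqrt (8 * pi) * (normal_density 0 2 t + normal_density 0 2 t * (t - 0)\<^sup>2) = exp (- t\<^sup>2 / 8) * (1 + t\<^sup>2)" for t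
  proof -
    have "normal_density 0 2 t = exp (- t\<^sup>2 / 8) / sqrt (8 * pi)"
      by (simp add: normal_density_def real_sqrt_mult)
    moreover have "sqrt (8 * pi) > 0" by simp
    ultimately show ?thesis by (simp add: distrib_left)
  qed
  have "integrable lborel (\<lambda>t. sqrt (8 * pi) * (normal_density 0 2 t + normal_density 0 2 t * (t - 0)\<^sup>2))"
    by (intro integrable_mult_right Bochner_Integration.integrable_add integrable_normal_moment) auto
  then show ?thesis unfolding eq .
qed

theorem (in prob_space) Berry_Esseen_moment:
  fixes Y :: "nat \<Rightarrow> 'a \<Rightarrow> real" and \<delta> :: real
  assumes indep: "indep_vars (\<lambda>_. borel) Y {1..}"
    and distr: "\<And>k. k \<ge> 1 \<Longrightarrow> distr M borel (Y k) = distr M borel (Y 1)"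
    and int: "integrable M (\<lambda>w. \<bar>Y 1 w\<bar> powr (2 + \<delta>))" and \<delta>: "0 < \<delta>" "\<delta> \<le> 1 / 2"
    and mean: "expectation (Y 1) = 0" and var: "expectation (\<lambda>w. (Y 1 w)\<^sup>2) = 1"
  shows "\<exists>C\<ge>0. \<forall>n\<ge>2. \<forall>x. \<bar>prob {w \<in> space M. (\<Sum>k=1..n. Y k w) / sqrt (real n) \<le> x}
      - cdf std_normal_distribution x\<bar> \<le> C * real n powr (- \<delta> / 2)"
proof -
  have rv [measurable]: "random_variable borel (Y k)" if "k \<ge> 1" for k
    using indep that by (auto simp: indep_vars_def2)
  have rv1 [measurable]: "random_variable borel (Y 1)" by (rule rv) simp
  define \<beta> where "\<beta> = expectation (\<lambda>w. \<bar>Y 1 w\<bar> powr (2 + \<delta>))"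
  have \<beta>0: "\<beta> \<ge> 0" by (simp add: \<beta>_def)
  define \<psi> where "\<psi> = char (distr M borel (Y 1))"
  \<comment> \<open>Chosen so that \<open>\<bar>t\<bar> \<le> s0 * sqrt n\<close> yields both
    frequency conditions of \<open>char_power_diff_le\<close>; \<open>\<beta> + 1\<close> keeps the
    denominator positive.\<close>
  define s0 where "s0 = min 1 ((1 / (4 * (\<beta> + 1))) powr (1 / \<delta>))"
  have s0: "0 < s0" "s0 \<le> 1" using \<beta>0 by (auto simp: s0_def)
  have s0_powr: "\<beta> * s0 powr \<delta> \<le> 1 / 4"
  proof -
    have "s0 powr \<delta> \<le> ((1 / (4 * (\<beta> + 1))) powr (1 / \<delta>)) powr \<delta>"
      using s0 \<delta> by (intro powr_mono2) (auto simp: s0_def)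
    also have "\<dots> = 1 / (4 * (\<beta> + 1))"
      using \<delta> \<beta>0 by (simp add: powr_powr)
    finally have "\<beta> * s0 powr \<delta> \<le> \<beta> * (1 / (4 * (\<beta> + 1)))"
      using \<beta>0 by (intro mult_left_mono) auto
    also have "\<dots> \<le> 1 / 4" using \<beta>0 by (simp add: field_simps)
    finally show ?thesis .
  qed
  \<comment> \<open>The 96 is 2 * 6 * 8: the trivial bound 2 on the difference of characteristic
    functions, the 6 of \<open>exp_minus_le_cube\<close>, and the cube of the 2 dividing the
    kernel's exponent. The other factors convert powers of \<open>\<bar>t\<bar>\<close> above
    \<open>s0 * sqrt n\<close> into powers of n and into 1 + t^2.\<close>
  define B where "B = 96 / s0 ^ 5 * (1 + 1 / s0\<^sup>2)"
  have B0: "B \<ge> 0" using s0 by (simp add: B_def)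
  define G1 where "G1 t = exp (- t\<^sup>2 / 8) * (1 + t\<^sup>2)" for t :: real
  define G2 where "G2 t = 1 / (1 + t\<^sup>2)" for t :: real
  have G1: "integrable lborel G1" "\<And>t. 0 \<le> G1 t"
    using integrable_exp_times_quadratic by (auto simp: G1_def[abs_def])
  have G2: "integrable lborel G2" "\<And>t. 0 \<le> G2 t"
    using integrable_one_over_1_plus_square by (auto simp: G2_def[abs_def])
  define C where "C = ((\<beta> + 1) * (\<integral>t. G1 t \<partial>lborel) + B * (\<integral>t. G2 t \<partial>lborel)) / pi + 4"
  have "C \<ge> 0"
    unfolding C_def using \<beta>0 B0 G1 G2 by (intro add_nonneg_nonneg divide_nonneg_nonneg mult_nonneg_nonneg) auto
  moreover have "\<bar>prob {w \<in> space M. (\<Sum>k=1..n. Y k w) / sqrt (real n) \<le> x}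
      - cdf std_normal_distribution x\<bar> \<le> C * real n powr (- \<delta> / 2)" if n: "n \<ge> 2" for n :: nat and x
  proof -
    define \<mu> where "\<mu> = distr M borel (\<lambda>w. \<Sum>k=1..n. Y k w / sqrt (real n))"
    have sum_rv: "random_variable borel (\<lambda>w. \<Sum>k=1..n. Y k w / sqrt (real n))"
      by (intro borel_measurable_sum borel_measurable_divide rv) auto
    have \<mu>: "real_distribution \<mu>"
      unfolding \<mu>_def using sum_rv by (rule real_distribution_distr)
    have char_\<mu>: "char \<mu> t = \<psi> (t / sqrt n) ^ n" for t
    proof -
      have "char \<mu> t = (\<Prod>k\<in>{1..n}. char (distr M borel (\<lambda>w. Y k w / sqrt n)) t)"
        unfolding \<mu>_def
        by (rule char_distr_sum, rule indep_vars_compose2[where X=Y], rule indep_vars_subset[OF indep]) auto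
      also have "\<dots> = (\<Prod>k\<in>{1..n}. \<psi> (t / sqrt n))"
      proof (rule prod.cong)
        fix k assume k: "k \<in> {1..n}"
        have "char (distr M borel (\<lambda>w. Y k w / sqrt n)) t = char (distr M borel (Y k)) (t / sqrt n)"
          using rv[of k] k by (simp add: char_def integral_distr)
        with k show "char (distr M borel (\<lambda>w. Y k w / sqrt n)) t = \<psi> (t / sqrt n)"
          using distr[of k] by (simp add: \<psi>_def)
      qed simp
      finally show ?thesis by simp
    qed
    \<comment> \<open>With these parameters \<open>\<eta> L\<close>, \<open>1 / L\<^sup>2\<close> and the part \<open>\<bar>t\<bar> > s0 sqrt n\<close> of the
      smoothing integral are all of order \<open>n powr (-1/4)\<close>.\<close>
    define \<eta> where "\<eta> = real n powr (- 3 / 8)"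
    define L where "L = real n powr (1 / 8)"
    have \<eta>0: "\<eta> > 0" and L0: "L > 0" using n by (auto simp: \<eta>_def L_def)
    \<comment> \<open>A sum of global majorants for low and for high frequencies instead of a
      piecewise function: each case below uses one summand, and the integrals of \<open>G1\<close>
      and \<open>G2\<close> do not depend on n.\<close>
    define g where "g t = (\<beta> + 1) * n powr (- \<delta> / 2) * G1 t + B * n powr (- 1 / 4) * G2 t" for t
    have g: "integrable lborel g" "\<And>t. 0 \<le> g t"
      unfolding g_def[abs_def] using G1 G2 \<beta>0 B0 by auto
    have le: "cmod (char \<mu> t - exp (- t\<^sup>2 / 2)) * exp (- (\<eta>\<^sup>2 * t\<^sup>2) / 2) \<le> \<bar>t\<bar> * g t" for t
    proof (cases "\<bar>t\<bar> \<le> s0 * sqrt n")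
      case True
      have "\<bar>t\<bar> \<le> sqrt n"
        using True s0 mult_right_mono[of s0 1 "sqrt n"] by simp
      moreover have "\<beta> * (\<bar>t\<bar> / sqrt n) powr \<delta> \<le> 1 / 4"
      proof -
        have "(\<bar>t\<bar> / sqrt n) powr \<delta> \<le> s0 powr \<delta>"
          using True n \<delta> by (intro powr_mono2) (auto simp: field_simps)
        then have "\<beta> * (\<bar>t\<bar> / sqrt n) powr \<delta> \<le> \<beta> * s0 powr \<delta>"
          using \<beta>0 by (intro mult_left_mono)
        with s0_powr show ?thesis by simp
      qed
      ultimately have "cmod (char \<mu> t - exp (- t\<^sup>2 / 2))
          \<le> (\<beta> + 1) * n powr (- \<delta> / 2) * \<bar>t\<bar> powr (2 + \<delta>) * exp (- t\<^sup>2 / 8)"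
        unfolding char_\<mu> \<psi>_def \<beta>_def using n \<delta>
        by (intro char_power_diff_le int mean var) auto
      also have "\<bar>t\<bar> powr (2 + \<delta>) = \<bar>t\<bar> * \<bar>t\<bar> powr (1 + \<delta>)"
        using powr_add[of "\<bar>t\<bar>" 1 "1 + \<delta>"] by (simp add: add.assoc)
      also have "(\<beta> + 1) * n powr (- \<delta> / 2) * (\<bar>t\<bar> * \<bar>t\<bar> powr (1 + \<delta>)) * exp (- t\<^sup>2 / 8)
          \<le> (\<beta> + 1) * n powr (- \<delta> / 2) * (\<bar>t\<bar> * (1 + t\<^sup>2)) * exp (- t\<^sup>2 / 8)"
      proof (intro mult_left_mono mult_right_mono)
        show "\<bar>t\<bar> powr (1 + \<delta>) \<le> 1 + t\<^sup>2"
        proof (cases "\<bar>t\<bar> \<le> 1")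
          case True
          then have "\<bar>t\<bar> powr (1 + \<delta>) \<le> 1" using \<delta> by (intro powr_le1) auto
          then show ?thesis by (simp add: add_increasing2)
        next
          case False
          then have "\<bar>t\<bar> powr (1 + \<delta>) \<le> \<bar>t\<bar> powr 2" using \<delta> by (intro powr_mono) auto
          then show ?thesis using False by simp
        qed
      qed (use \<beta>0 in auto)
      also have "\<dots> \<le> \<bar>t\<bar> * g t"
        using B0 by (simp add: g_def G1_def G2_def algebra_simps)
      finally have "cmod (char \<mu> t - exp (- t\<^sup>2 / 2)) \<le> \<bar>t\<bar> * g t" .
      moreover have "exp (- (\<eta>\<^sup>2 * t\<^sup>2) / 2) \<le> 1" by simp
      ultimately have "cmod (char \<mu> t - exp (- t\<^sup>2 / 2)) * exp (- (\<eta>\<^sup>2 * t\<^sup>2) / 2) \<le> (\<bar>t\<bar> * g t) * 1"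
        using g by (intro mult_mono) auto
      then show ?thesis by simp
    next
      case False
      define T where "T = \<bar>t\<bar>"
      have T: "T > s0 * sqrt n" "T > 0"
        using False s0 by (auto simp: T_def intro: le_less_trans[of 0 "s0 * sqrt n"])
      \<comment> \<open>Both characteristic functions are only bounded by 1 here; the decay is that
        of the kernel.\<close>
      have "cmod (char \<mu> t - exp (- t\<^sup>2 / 2)) \<le> cmod (char \<mu> t) + cmod (exp (- t\<^sup>2 / 2))"
        by (rule norm_triangle_ineq4)
      also have "\<dots> \<le> 1 + 1"
        by (intro add_mono real_distribution.cmod_char_le_1[OF \<mu>]) simp_all
      finally have "cmod (char \<mu> t - exp (- t\<^sup>2 / 2)) * exp (- (\<eta>\<^sup>2 * t\<^sup>2) / 2) \<le> 2 * exp (- (\<eta>\<^sup>2 * t\<^sup>2 / 2))"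
        by simp
      also have "\<dots> \<le> 2 * (6 / (\<eta>\<^sup>2 * t\<^sup>2 / 2) ^ 3)"
        using \<eta>0 T by (intro mult_left_mono exp_minus_le_cube) (auto simp: T_def)
      also have "\<dots> = 96 / (\<eta> ^ 6 * T ^ 6)"
        by (simp add: T_def field_simps)
      also have "\<eta> ^ 6 = real n powr (- 9 / 4)"
        unfolding \<eta>_def using n by (simp add: powr_powr flip: powr_realpow)
      \<comment> \<open>After division by T, seven powers of T are available. Five are traded
        through T > s0 * sqrt n for n powr (- 5/2), turning n powr (9/4) into n powr (- 1/4); two
        remain for integrability.\<close>
      also have "96 / (real n powr (- 9 / 4) * T ^ 6) \<le> T * (B * real n powr (- 1 / 4) * G2 t)"
      proof -
        have 1: "s0 ^ 5 * real n powr (5 / 2) \<le> T ^ 5"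
        proof -
          have "(s0 * sqrt n) ^ 5 \<le> T ^ 5" using T s0 by (intro power_mono) auto
          moreover have "sqrt n ^ 5 = real n powr (5 / 2)"
            using n sqrt_powr[of "real n" 5] by simp
          ultimately show ?thesis by (simp add: power_mult_distrib)
        qed
        have 2: "1 + T\<^sup>2 \<le> (1 + 1 / s0\<^sup>2) * T\<^sup>2"
        proof -
          have "s0 \<le> T"
          proof -
            have "s0 * 1 \<le> s0 * sqrt n" using s0 n by (intro mult_left_mono) auto
            with T(1) show ?thesis by linarith
          qed
          then have "s0\<^sup>2 \<le> T\<^sup>2" using s0 by (intro power_mono) auto
          then have "1 \<le> 1 / s0\<^sup>2 * T\<^sup>2" using s0 by (simp add: field_simps)
          then show ?thesis by (simp add: algebra_simps)
        qed
        define c where "c = 1 + 1 / s0\<^sup>2"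
        have c: "c > 0" by (simp add: c_def add_pos_nonneg)
        have "(s0 ^ 5 * real n powr (5 / 2)) * (1 + T\<^sup>2) \<le> T ^ 5 * (c * T\<^sup>2)"
          unfolding c_def using T by (intro mult_mono 1 2) auto
        then have "c / (T ^ 5 * (c * T\<^sup>2)) \<le> c / ((s0 ^ 5 * real n powr (5 / 2)) * (1 + T\<^sup>2))"
          using T s0 n c by (intro divide_left_mono mult_pos_pos add_pos_nonneg) auto
        also have "c / (T ^ 5 * (c * T\<^sup>2)) = 1 / (T ^ 5 * T\<^sup>2)"
          using c by simp
        finally have "96 * real n powr (9 / 4) * T * (1 / (T ^ 5 * T\<^sup>2))
            \<le> 96 * real n powr (9 / 4) * T * (c / ((s0 ^ 5 * real n powr (5 / 2)) * (1 + T\<^sup>2)))"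
          using T by (intro mult_left_mono) auto
        also have "\<dots> = T * (96 / s0 ^ 5 * c * (real n powr (9 / 4) / real n powr (5 / 2)) * (1 / (1 + T\<^sup>2)))"
          by simp
        also have "\<dots> = T * (B * (real n powr (9 / 4) / real n powr (5 / 2)) * G2 t)"
          by (simp only: B_def G2_def c_def T_def power2_abs)
        also have "real n powr (9 / 4) / real n powr (5 / 2) = real n powr (- 1 / 4)"
          by (simp flip: powr_diff)
        also have "96 * real n powr (9 / 4) * T * (1 / (T ^ 5 * T\<^sup>2)) = 96 / (real n powr (- 9 / 4) * T ^ 6)"
          using T by (simp add: powr_minus field_simps eval_nat_numeral)
        finally show ?thesis .
      qed
      also have "\<dots> \<le> \<bar>t\<bar> * g t"
        using \<beta>0 G1 by (auto simp: T_def g_def intro!: mult_left_mono)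
      finally show ?thesis .
    qed
    have "\<bar>cdf \<mu> x - cdf std_normal_distribution x\<bar> \<le> (\<integral>t. g t \<partial>lborel) / pi + 2 * \<eta> * L + 2 / L\<^sup>2"
      by (rule smoothing_inequality[OF \<mu> \<eta>0 L0 g le])
    also have "(\<integral>t. g t \<partial>lborel) = (\<beta> + 1) * n powr (- \<delta> / 2) * (\<integral>t. G1 t \<partial>lborel)
        + B * n powr (- 1 / 4) * (\<integral>t. G2 t \<partial>lborel)"
      unfolding g_def using G1 G2 by simp
    also have "2 * \<eta> * L = 2 * n powr (- 1 / 4)"
      unfolding \<eta>_def L_def by (simp flip: powr_add)
    also have "2 / L\<^sup>2 = 2 * n powr (- 1 / 4)"
    proof -
      have "L\<^sup>2 = n powr (1 / 4)" unfolding L_def using n by (simp add: powr_powr flip: powr_realpow)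
      then show ?thesis by (simp add: powr_minus field_simps)
    qed
    \<comment> \<open>As \<delta> \<le> 1/2, n powr (- 1/4) is at most n powr (- \<delta>/2). The
      two smoothing costs give the summand 4 of \<open>C\<close>.\<close>
    also have "((\<beta> + 1) * n powr (- \<delta> / 2) * (\<integral>t. G1 t \<partial>lborel)
        + B * n powr (- 1 / 4) * (\<integral>t. G2 t \<partial>lborel)) / pi + 2 * n powr (- 1 / 4) + 2 * n powr (- 1 / 4)
        \<le> ((\<beta> + 1) * n powr (- \<delta> / 2) * (\<integral>t. G1 t \<partial>lborel)
        + B * n powr (- \<delta> / 2) * (\<integral>t. G2 t \<partial>lborel)) / pi + 2 * n powr (- \<delta> / 2) + 2 * n powr (- \<delta> / 2)"
      using n \<delta> \<beta>0 B0 G1 G2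
      by (intro add_mono divide_right_mono mult_left_mono mult_right_mono powr_mono) auto
    also have "\<dots> = C * n powr (- \<delta> / 2)"
      by (simp add: C_def field_simps)
    also have "cdf \<mu> x = prob {w \<in> space M. (\<Sum>k=1..n. Y k w) / sqrt (real n) \<le> x}"
      unfolding \<mu>_def cdf_def using sum_rv
      by (subst measure_distr) (auto simp: sum_divide_distrib intro!: arg_cong[where f=prob])
    finally show ?thesis .
  qed
  ultimately show ?thesis by blast
qed

section \<open>The jackknife estimator of a fixed sample\<close>

lemma entropy_of_finite_support:
  assumes "finite S" "S \<subseteq> {1..}" "\<And>i. i \<ge> 1 \<Longrightarrow> i \<notin> S \<Longrightarrow> f i = 0"
  shows "entropy_of f = - (\<Sum>i\<in>S. f i * ln (f i))"
proof -
  have "(\<Sum>\<^sub>\<infinity>i\<in>{1..}. f i * ln (f i)) = (\<Sum>\<^sub>\<infinity>i\<in>S. f i * ln (f i))"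
    by (rule infsum_cong_neutral) (use assms in auto)
  then show ?thesis using assms by (simp add: entropy_of_def)
qed

text \<open>Equals (m - 1) (ln m - ln (m - 1)) for m > 1, the logarithmic effect of deleting one of
  m occurrences. At m = 1 the factor m - 1 makes it 0, as is right for a letter that
  disappears.\<close>

definition jack_weight :: "real \<Rightarrow> real" where
  "jack_weight m = (m - 1) * ln (m / (m - 1))"

text \<open>The inequality ln y \<le> y - 1, applied to \<open>m / (m - 1)\<close> and to its
  reciprocal.\<close>

lemma jack_weight_bounds:
  assumes "m \<ge> 1"
  shows "1 - 1 / m \<le> jack_weight m" "jack_weight m \<le> 1"
proof -
  consider "m = 1" | "m > 1" using assms by linarith
  then have "1 - 1 / m \<le> jack_weight m \<and> jack_weight m \<le> 1"
  proof cases
    case 2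
    have "ln (m / (m - 1)) \<le> m / (m - 1) - 1"
      using 2 by (intro ln_le_minus_one) auto
    also have "\<dots> = 1 / (m - 1)" using 2 by (simp add: field_simps)
    finally have "(m - 1) * ln (m / (m - 1)) \<le> (m - 1) * (1 / (m - 1))"
      using 2 by (intro mult_left_mono) auto
    moreover have "ln ((m - 1) / m) \<le> (m - 1) / m - 1"
      using 2 by (intro ln_le_minus_one) auto
    then have "1 / m \<le> ln (m / (m - 1))"
      using 2 by (simp add: ln_div field_simps)
    then have "(m - 1) * (1 / m) \<le> (m - 1) * ln (m / (m - 1))"
      using 2 by (intro mult_left_mono) auto
    ultimately show ?thesis
      using 2 by (simp add: jack_weight_def diff_divide_distrib)
  qed (simp add: jack_weight_def)
  then show "1 - 1 / m \<le> jack_weight m" "jack_weight m \<le> 1" by auto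
qed

text \<open>Since c \<le> m, both values lie between 1 - 1/c and 1.\<close>

lemma jack_weight_diff_le:
  assumes "1 \<le> c" "c \<le> m"
  shows "\<bar>jack_weight m - jack_weight c\<bar> \<le> 1 / c"
proof -
  have "1 / m \<le> 1 / c" using assms by (intro divide_left_mono) auto
  then show ?thesis
    using jack_weight_bounds[of c] jack_weight_bounds[of m] assms by (auto simp: abs_le_iff)
qed

text \<open>The share of one letter, with m = n - 1: of the m + 1 deletions, \<open>c\<close> lower
  its count to c - 1 and the others leave it unchanged.\<close>

lemma jackknife_term:
  fixes c m :: real
  assumes c: "c \<ge> 1" and m: "m > 0"
  shows "(m + 1) * (- ((c / (m + 1)) * ln (c / (m + 1))))
      + m / (m + 1) * (c * ((c - 1) / m * ln ((c - 1) / m)) + (m + 1 - c) * (c / m * ln (c / m)))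
    = - ((c / (m + 1)) * ln (c / (m + 1))) + c / (m + 1) * (jack_weight (m + 1) - jack_weight c)"
proof -
  \<comment> \<open>With the logarithms made opaque the claim is a rational identity. For c = 1 the
    value of \<open>ln (c - 1)\<close> is harmless, being multiplied by 0.\<close>
  define lc lc1 lm ln1 where "lc = ln c" and "lc1 = ln (c - 1)" and "lm = ln m" and "ln1 = ln (m + 1)"
  have 1: "(c - 1) / m * ln ((c - 1) / m) = (c - 1) / m * (lc1 - lm)"
    using c m by (cases "c = 1") (auto simp: ln_div lc1_def lm_def)
  have 2: "jack_weight c = (c - 1) * (lc - lc1)"
    using c by (cases "c = 1") (auto simp: jack_weight_def ln_div lc1_def lc_def)
  have 3: "jack_weight (m + 1) = m * (ln1 - lm)"
    using m by (auto simp: jack_weight_def ln_div ln1_def lm_def)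
  have 4: "ln (c / (m + 1)) = lc - ln1" "ln (c / m) = lc - lm"
    using c m by (auto simp: ln_div ln1_def lc_def lm_def)
  have "m \<noteq> 0" "m + 1 \<noteq> 0" using m by auto
  then show ?thesis
    unfolding 1 2 3 4 by (simp add: divide_simps) (simp add: algebra_simps)
qed

section \<open>Letter counts of a deterministic index sequence\<close>

definition occ :: "(nat \<Rightarrow> nat) \<Rightarrow> nat \<Rightarrow> nat \<Rightarrow> real" where
  "occ x n i = (\<Sum>k=1..n. of_bool (x k = i))"

context
  fixes a :: "nat \<Rightarrow> 'a" and x :: "nat \<Rightarrow> nat" and n :: nat
  assumes inj: "inj_on a {1..}" and x: "\<And>k. k \<in> {1..n} \<Longrightarrow> x k \<ge> 1"
begin

lemma occ_eq: "i \<ge> 1 \<Longrightarrow> (\<Sum>k=1..n. of_bool (a (x k) = a i)) = occ x n i"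
  unfolding occ_def
  by (intro sum.cong refl arg_cong[where f=of_bool]) (use x inj in \<open>auto dest: inj_onD\<close>)

lemma occ_nonneg: "0 \<le> occ x n i"
  by (simp add: occ_def sum_nonneg)

lemma occ_outside: "i \<notin> x ` {1..n} \<Longrightarrow> occ x n i = 0"
  by (auto simp: occ_def intro!: sum.neutral)

lemma occ_ge_1: "i \<in> x ` {1..n} \<Longrightarrow> occ x n i \<ge> 1"
proof -
  assume "i \<in> x ` {1..n}"
  then obtain k where k: "k \<in> {1..n}" "x k = i" by auto
  have "of_bool (x k = i) \<le> (\<Sum>k=1..n. of_bool (x k = i) :: real)"
    by (rule member_le_sum) (use k in auto)
  with k show ?thesis by (simp add: occ_def)
qed

lemma occ_le: "occ x n i \<le> n"
proof -
  have "occ x n i \<le> (\<Sum>k=1..n. 1)" unfolding occ_def by (rule sum_mono) simp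
  then show ?thesis by simp
qed

text \<open>Groups the observations by letter; this is the passage between sums over letters and
  sample averages.\<close>

lemma sum_occ_times: "(\<Sum>i\<in>x ` {1..n}. occ x n i * h i) = (\<Sum>k=1..n. h (x k))"
proof -
  have "(\<Sum>i\<in>x ` {1..n}. occ x n i * h i) = (\<Sum>k=1..n. \<Sum>i\<in>x ` {1..n}. of_bool (x k = i) * h i)"
    unfolding occ_def sum_distrib_right by (rule sum.swap)
  also have "\<dots> = (\<Sum>k=1..n. h (x k))"
  proof (rule sum.cong)
    fix k assume k: "k \<in> {1..n}"
    have "(\<Sum>i\<in>x ` {1..n}. of_bool (x k = i) * h i) = (\<Sum>i\<in>x ` {1..n}. if x k = i then h i else 0)"
      by (rule sum.cong) auto
    then show "(\<Sum>i\<in>x ` {1..n}. of_bool (x k = i) * h i) = h (x k)"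
      using k by (simp add: sum.delta')
  qed simp
  finally show ?thesis .
qed

text \<open>The outcome is the index sequence \<open>x\<close> itself and the observations are its
  coordinates relabelled by \<open>a\<close>, which frees this part from probability.\<close>

lemma plugin_entropy_eq:
  "plugin_entropy a (\<lambda>k t. a (t k)) n x = - (\<Sum>i\<in>x ` {1..n}. occ x n i / n * ln (occ x n i / n))"
proof -
  have freq: "emp_freq a (\<lambda>k t. a (t k)) n x i = occ x n i / n" if "i \<ge> 1" for i
    using that by (simp only: emp_freq_def occ_eq)
  have "plugin_entropy a (\<lambda>k t. a (t k)) n x
      = - (\<Sum>i\<in>x ` {1..n}. emp_freq a (\<lambda>k t. a (t k)) n x i * ln (emp_freq a (\<lambda>k t. a (t k)) n x i))"
    unfolding plugin_entropy_def
    by (rule entropy_of_finite_support) (use x freq occ_outside in auto)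
  also have "\<dots> = - (\<Sum>i\<in>x ` {1..n}. occ x n i / n * ln (occ x n i / n))"
    by (intro arg_cong[where f=uminus] sum.cong refl) (use freq x in auto)
  finally show ?thesis .
qed

text \<open>A letter lost by the deletion stays in the index set with the term 0 * ln 0 = 0, so one
  set serves every \<open>j\<close>.\<close>

lemma plugin_entropy_del_eq:
  assumes j: "j \<in> {1..n}"
  shows "plugin_entropy_del a (\<lambda>k t. a (t k)) n j x = - (\<Sum>i\<in>x ` {1..n}.
    (occ x n i - of_bool (x j = i)) / (real n - 1) * ln ((occ x n i - of_bool (x j = i)) / (real n - 1)))"
proof -
  have freq: "emp_freq_del a (\<lambda>k t. a (t k)) n j x i = (occ x n i - of_bool (x j = i)) / (real n - 1)"
    if "i \<ge> 1" for i
  proof -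
    have "a (x j) = a i \<longleftrightarrow> x j = i" using x[OF j] that inj by (auto dest: inj_onD)
    with that show ?thesis by (simp only: emp_freq_del_def occ_eq)
  qed
  have "plugin_entropy_del a (\<lambda>k t. a (t k)) n j x
      = - (\<Sum>i\<in>x ` {1..n}. emp_freq_del a (\<lambda>k t. a (t k)) n j x i * ln (emp_freq_del a (\<lambda>k t. a (t k)) n j x i))"
    unfolding plugin_entropy_del_def
    by (rule entropy_of_finite_support) (use x freq j occ_outside in auto)
  also have "\<dots> = - (\<Sum>i\<in>x ` {1..n}.
      (occ x n i - of_bool (x j = i)) / (real n - 1) * ln ((occ x n i - of_bool (x j = i)) / (real n - 1)))"
    by (intro arg_cong[where f=uminus] sum.cong refl) (use freq x in auto)
  finally show ?thesis .
qed

lemma jackknife_entropy_eq: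
  assumes n: "n \<ge> 2"
  shows "jackknife_entropy a (\<lambda>k t. a (t k)) n x = plugin_entropy a (\<lambda>k t. a (t k)) n x
    + (\<Sum>i\<in>x ` {1..n}. occ x n i / n * (jack_weight n - jack_weight (occ x n i)))"
proof -
  define m where "m = real n - 1"
  have m: "m > 0" and nm: "real n = m + 1" using n by (auto simp: m_def)
  define g where "g y = y * ln y" for y :: real
  let ?S = "x ` {1..n}"
  have "(\<Sum>j=1..n. plugin_entropy_del a (\<lambda>k t. a (t k)) n j x)
      = - (\<Sum>j=1..n. \<Sum>i\<in>?S. g ((occ x n i - of_bool (x j = i)) / m))"
    using plugin_entropy_del_eq by (simp add: g_def m_def sum_negf)
  also have "(\<Sum>j=1..n. \<Sum>i\<in>?S. g ((occ x n i - of_bool (x j = i)) / m))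
      = (\<Sum>i\<in>?S. \<Sum>j=1..n. g ((occ x n i - of_bool (x j = i)) / m))"
    by (rule sum.swap)
  also have "\<dots> = (\<Sum>i\<in>?S. occ x n i * g ((occ x n i - 1) / m) + (m + 1 - occ x n i) * g (occ x n i / m))"
  proof (rule sum.cong)
    fix i
    \<comment> \<open>As \<open>of_bool\<close> takes only the values 0 and 1, the summand is affine
      in it, and the sum over \<open>j\<close> just counts the deletions that hit letter
      \<open>i\<close>.\<close>
    have "(\<Sum>j=1..n. g ((occ x n i - of_bool (x j = i)) / m))
        = (\<Sum>j=1..n. of_bool (x j = i) * (g ((occ x n i - 1) / m) - g (occ x n i / m)) + g (occ x n i / m))"
      by (rule sum.cong) auto
    also have "\<dots> = occ x n i * (g ((occ x n i - 1) / m) - g (occ x n i / m)) + n * g (occ x n i / m)"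
      by (simp add: sum.distrib occ_def flip: sum_distrib_right)
    finally show "(\<Sum>j=1..n. g ((occ x n i - of_bool (x j = i)) / m))
        = occ x n i * g ((occ x n i - 1) / m) + (m + 1 - occ x n i) * g (occ x n i / m)"
      by (simp add: nm algebra_simps)
  qed simp
  finally have del: "(\<Sum>j=1..n. plugin_entropy_del a (\<lambda>k t. a (t k)) n j x)
    = - (\<Sum>i\<in>?S. occ x n i * g ((occ x n i - 1) / m) + (m + 1 - occ x n i) * g (occ x n i / m))" .
  define B where "B i = occ x n i * g ((occ x n i - 1) / m) + (m + 1 - occ x n i) * g (occ x n i / m)" for i
  have plugin: "plugin_entropy a (\<lambda>k t. a (t k)) n x = - (\<Sum>i\<in>?S. g (occ x n i / (m + 1)))"
    by (simp only: plugin_entropy_eq g_def nm)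
  have "jackknife_entropy a (\<lambda>k t. a (t k)) n x = (m + 1) * - (\<Sum>i\<in>?S. g (occ x n i / (m + 1)))
      + m / (m + 1) * (\<Sum>i\<in>?S. B i)"
    unfolding jackknife_entropy_def plugin del B_def[symmetric] by (simp add: nm)
  also have "\<dots> = (\<Sum>i\<in>?S. (m + 1) * - g (occ x n i / (m + 1)) + m / (m + 1) * B i)"
    by (simp only: sum.distrib sum_distrib_left sum_negf[symmetric])
  also have "\<dots> = (\<Sum>i\<in>?S. - g (occ x n i / (m + 1)) + occ x n i / (m + 1) * (jack_weight (m + 1) - jack_weight (occ x n i)))"
    unfolding g_def B_def using m occ_ge_1 by (intro sum.cong refl jackknife_term) auto
  also have "\<dots> = plugin_entropy a (\<lambda>k t. a (t k)) n x
    + (\<Sum>i\<in>x ` {1..n}. occ x n i / n * (jack_weight n - jack_weight (occ x n i)))"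
    unfolding plugin by (simp only: nm sum.distrib sum_negf)
  finally show ?thesis .
qed

text \<open>A letter seen c times contributes at most c/n * 1/c = 1/n.\<close>

lemma jackknife_correction_le:
  assumes n: "n \<ge> 2"
  shows "\<bar>\<Sum>i\<in>x ` {1..n}. occ x n i / n * (jack_weight n - jack_weight (occ x n i))\<bar> \<le> card (x ` {1..n}) / n"
proof -
  have "\<bar>\<Sum>i\<in>x ` {1..n}. occ x n i / n * (jack_weight n - jack_weight (occ x n i))\<bar>
      \<le> (\<Sum>i\<in>x ` {1..n}. \<bar>occ x n i / n * (jack_weight n - jack_weight (occ x n i))\<bar>)"
    by (rule sum_abs)
  also have "\<dots> \<le> (\<Sum>i\<in>x ` {1..n}. 1 / n)"
  proof (rule sum_mono)
    fix i assume i: "i \<in> x ` {1..n}"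
    have "\<bar>occ x n i / n * (jack_weight n - jack_weight (occ x n i))\<bar>
        = occ x n i / n * \<bar>jack_weight n - jack_weight (occ x n i)\<bar>"
      using occ_nonneg[of i] by (simp add: abs_mult)
    also have "\<dots> \<le> occ x n i / n * (1 / occ x n i)"
      using occ_ge_1[OF i] occ_le[of i] by (intro mult_left_mono jack_weight_diff_le) auto
    finally show "\<bar>occ x n i / n * (jack_weight n - jack_weight (occ x n i))\<bar> \<le> 1 / n"
      using occ_ge_1[OF i] by simp
  qed
  finally show ?thesis by simp
qed

text \<open>There are at most \<open>N\<close> indices below \<open>N\<close>, and every other
  distinct index uses up at least one observation.\<close>

lemma card_range_le:
  "real (card (x ` {1..n})) \<le> real N + (\<Sum>k=1..n. of_bool (N \<le> x k))"
proof -
  have "x ` {1..n} \<subseteq> {..<N} \<union> x ` ({1..n} \<inter> {k. N \<le> x k})" by auto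
  then have "card (x ` {1..n}) \<le> card ({..<N} \<union> x ` ({1..n} \<inter> {k. N \<le> x k}))"
    by (intro card_mono) auto
  also have "\<dots> \<le> card {..<N} + card (x ` ({1..n} \<inter> {k. N \<le> x k}))"
    by (rule card_Un_le)
  also have "\<dots> \<le> N + card ({1..n} \<inter> {k. N \<le> x k})"
    using card_image_le[of "{1..n} \<inter> {k. N \<le> x k}" x] by simp
  finally show ?thesis
    by (simp only: sum_of_bool_eq finite_atLeastAtMost of_nat_add[symmetric] of_nat_le_iff)
qed

text \<open>The relative entropy of the empirical distribution with respect to \<open>p\<close>: below \<open>N\<close> it is
  dominated by the \<open>\<chi>\<^sup>2\<close> distance, from \<open>N\<close> on by the cross entropy.\<close>

lemma relative_entropy_bounds:
  assumes n: "n \<ge> 1" and p: "\<And>k. k \<in> {1..n} \<Longrightarrow> p (x k) > 0"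
    and p1: "\<And>S. finite S \<Longrightarrow> S \<subseteq> {1..} \<Longrightarrow> sum p S \<le> 1"
  defines "D \<equiv> (\<Sum>i\<in>x ` {1..n}. occ x n i / n * ln (occ x n i / n / p i))"
  shows "0 \<le> D"
    and "D \<le> (\<Sum>i\<in>{1..<N}. (occ x n i / n)\<^sup>2 / p i - occ x n i / n)
      + (\<Sum>k=1..n. of_bool (N \<le> x k) * - ln (p (x k))) / n"
proof -
  let ?S = "x ` {1..n}"
  have pos: "p i > 0" "occ x n i > 0" if "i \<in> ?S" for i
    using p that occ_ge_1[OF that] by auto
  have S1: "?S \<subseteq> {1..}" using x by auto
  have occ1: "(\<Sum>i\<in>?S. occ x n i / n) = 1"
    using sum_occ_times[of "\<lambda>_. 1 / n"] n by (simp add: sum_divide_distrib[symmetric])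
  \<comment> \<open>Gibbs' inequality: the observed letters have total frequency 1 but total
    probability at most 1.\<close>
  have "(\<Sum>i\<in>?S. occ x n i / n - p i) \<le> D"
    unfolding D_def
  proof (rule sum_mono)
    fix i assume i: "i \<in> ?S"
    define q where "q = occ x n i / n"
    have q: "q > 0" using pos[OF i] n by (simp add: q_def)
    have "ln (p i / q) \<le> p i / q - 1" using pos[OF i] q by (intro ln_le_minus_one) simp
    moreover have "ln (q / p i) = - ln (p i / q)"
      using pos[OF i] q by (simp add: ln_div)
    ultimately have "q * (1 - p i / q) \<le> q * ln (q / p i)"
      using q by (intro mult_left_mono) auto
    then have "q - p i \<le> q * ln (q / p i)"
      using q by (simp add: right_diff_distrib)
    then show "occ x n i / n - p i \<le> occ x n i / n * ln (occ x n i / n / p i)"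
      by (simp only: q_def)
  qed
  moreover have "(\<Sum>i\<in>?S. occ x n i / n - p i) = 1 - sum p ?S"
    by (simp only: sum_subtractf occ1)
  moreover have "sum p ?S \<le> 1" using S1 by (intro p1) auto
  ultimately show "0 \<le> D" by linarith
  have "D \<le> (\<Sum>i\<in>?S. of_bool (i < N) * ((occ x n i / n)\<^sup>2 / p i - occ x n i / n)
      + occ x n i * (of_bool (N \<le> i) * - ln (p i) / n))"
    unfolding D_def
  proof (rule sum_mono)
    fix i assume i: "i \<in> ?S"
    define q where "q = occ x n i / n"
    have q: "0 < q" "q \<le> 1" using pos[OF i] occ_le[of i] n by (auto simp: q_def)
    \<comment> \<open>Below \<open>N\<close>, ln y \<le> y - 1 is applied to y = q / p i; from
      \<open>N\<close> on, q \<le> 1 allows ln q to be dropped.\<close>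
    have "q * ln (q / p i) \<le> of_bool (i < N) * (q\<^sup>2 / p i - q) + q * (of_bool (N \<le> i) * - ln (p i))"
    proof (cases "i < N")
      case True
      have "ln (q / p i) \<le> q / p i - 1" using pos[OF i] q by (intro ln_le_minus_one) simp
      then have "q * ln (q / p i) \<le> q * (q / p i - 1)"
        using q by (intro mult_left_mono) auto
      with True show ?thesis by (simp add: power2_eq_square right_diff_distrib)
    next
      case False
      have "ln q \<le> 0" using q by simp
      then have "q * ln (q / p i) \<le> q * - ln (p i)"
        using q pos[OF i] by (intro mult_left_mono) (auto simp: ln_div)
      with False show ?thesis by simp
    qed
    then show "occ x n i / n * ln (occ x n i / n / p i) \<le> of_bool (i < N) * ((occ x n i / n)\<^sup>2 / p i - occ x n i / n)
      + occ x n i * (of_bool (N \<le> i) * - ln (p i) / n)"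
      by (simp add: q_def)
  qed
  also have "\<dots> = (\<Sum>i\<in>?S. of_bool (i < N) * ((occ x n i / n)\<^sup>2 / p i - occ x n i / n))
      + (\<Sum>k=1..n. of_bool (N \<le> x k) * - ln (p (x k)) / n)"
    unfolding sum.distrib using sum_occ_times[of "\<lambda>i. of_bool (N \<le> i) * - ln (p i) / n"] by simp
  also have "(\<Sum>i\<in>?S. of_bool (i < N) * ((occ x n i / n)\<^sup>2 / p i - occ x n i / n))
      = (\<Sum>i\<in>?S \<inter> {1..<N}. (occ x n i / n)\<^sup>2 / p i - occ x n i / n)"
    using S1 by (intro sum.mono_neutral_cong_right) auto
  \<comment> \<open>Unobserved letters contribute exactly 0, so the sample-dependent index set
    becomes a fixed one over which expectations can be taken termwise.\<close>
  also have "\<dots> = (\<Sum>i\<in>{1..<N}. (occ x n i / n)\<^sup>2 / p i - occ x n i / n)"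
  proof (rule sum.mono_neutral_left)
    show "\<forall>i\<in>{1..<N} - ?S \<inter> {1..<N}. (occ x n i / n)\<^sup>2 / p i - occ x n i / n = 0"
    proof
      fix i assume "i \<in> {1..<N} - ?S \<inter> {1..<N}"
      then have "i \<notin> ?S" by blast
      then have "occ x n i = 0" by (rule occ_outside)
      then show "(occ x n i / n)\<^sup>2 / p i - occ x n i / n = 0" by simp
    qed
  qed auto
  finally show "D \<le> (\<Sum>i\<in>{1..<N}. (occ x n i / n)\<^sup>2 / p i - occ x n i / n)
      + (\<Sum>k=1..n. of_bool (N \<le> x k) * - ln (p (x k))) / n"
    by (simp only: sum_divide_distrib)
qed

text \<open>The plug-in error is exactly the negative relative entropy; as that entropy is
  nonnegative, its upper bound also controls the absolute value. \<open>N\<close> stays free, and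
  the right-hand side consists of terms with accessible expectations.\<close>

lemma jackknife_remainder_le:
  assumes n: "n \<ge> 2" and p: "\<And>k. k \<in> {1..n} \<Longrightarrow> p (x k) > 0"
    and p1: "\<And>S. finite S \<Longrightarrow> S \<subseteq> {1..} \<Longrightarrow> sum p S \<le> 1"
  shows "\<bar>jackknife_entropy a (\<lambda>k t. a (t k)) n x + (\<Sum>k=1..n. ln (p (x k))) / n\<bar>
    \<le> (\<Sum>i\<in>{1..<N}. (occ x n i / n)\<^sup>2 / p i - occ x n i / n)
      + (\<Sum>k=1..n. of_bool (N \<le> x k) * - ln (p (x k))) / n
      + (real N + (\<Sum>k=1..n. of_bool (N \<le> x k))) / n"
proof -
  have "(\<Sum>k=1..n. ln (p (x k))) / n = (\<Sum>i\<in>x ` {1..n}. occ x n i / n * ln (p i))"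
    using sum_occ_times[of "\<lambda>i. ln (p i) / n"] by (simp add: sum_divide_distrib)
  then have "plugin_entropy a (\<lambda>k t. a (t k)) n x + (\<Sum>k=1..n. ln (p (x k))) / n
      = - (\<Sum>i\<in>x ` {1..n}. occ x n i / n * ln (occ x n i / n) - occ x n i / n * ln (p i))"
    by (simp add: plugin_entropy_eq sum_subtractf)
  also have "(\<Sum>i\<in>x ` {1..n}. occ x n i / n * ln (occ x n i / n) - occ x n i / n * ln (p i))
      = (\<Sum>i\<in>x ` {1..n}. occ x n i / n * ln (occ x n i / n / p i))"
  proof (rule sum.cong)
    fix i assume i: "i \<in> x ` {1..n}"
    define q where "q = occ x n i / n"
    have "p i > 0" "q > 0" using i p occ_ge_1[OF i] n by (auto simp: q_def)
    then have "q * ln q - q * ln (p i) = q * ln (q / p i)"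
      by (simp add: ln_div right_diff_distrib)
    then show "occ x n i / n * ln (occ x n i / n) - occ x n i / n * ln (p i) = occ x n i / n * ln (occ x n i / n / p i)"
      by (simp only: q_def)
  qed simp
  finally have plugin: "plugin_entropy a (\<lambda>k t. a (t k)) n x + (\<Sum>k=1..n. ln (p (x k))) / n
      = - (\<Sum>i\<in>x ` {1..n}. occ x n i / n * ln (occ x n i / n / p i))" .
  have n1: "n \<ge> 1" using n by simp
  have "real (card (x ` {1..n})) / n \<le> (real N + (\<Sum>k=1..n. of_bool (N \<le> x k))) / n"
    by (intro divide_right_mono card_range_le) simp
  then show ?thesis
    using relative_entropy_bounds(1)[OF n1 p p1] relative_entropy_bounds(2)[OF n1 p p1, of N]
      jackknife_correction_le[OF n] plugin
    unfolding jackknife_entropy_eq[OF n] by linarith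
qed

end

section \<open>Moments of the remainder\<close>

context prob_space
begin

text \<open>Outside the event r \<le> V, the variables \<open>A\<close> and \<open>W\<close> differ
  by less than r. The distribution function of \<open>W\<close> need not be Lipschitz, so the shift
  is absorbed by the normal one after applying \<open>BE\<close> at x + r and x - r.\<close>

lemma cdf_perturbation:
  fixes W A V :: "'a \<Rightarrow> real"
  assumes [measurable]: "random_variable borel W" "random_variable borel A" and V: "integrable M V"
    and AW: "AE w in M. \<bar>A w - W w\<bar> \<le> V w" and r: "r > 0"
    and BE: "\<And>x. \<bar>prob {w \<in> space M. W w \<le> x} - cdf std_normal_distribution x\<bar> \<le> b"
  shows "\<bar>prob {w \<in> space M. A w \<le> x} - cdf std_normal_distribution x\<bar> \<le> b + r + expectation V / r"
proof -
  note [measurable] = borel_measurable_integrable[OF V]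
  have V0: "AE w in M. 0 \<le> V w" using AW by eventually_elim auto
  have markov: "prob {w \<in> space M. r \<le> V w} \<le> expectation V / r"
    by (rule integral_Markov_inequality_measure[OF V sets.top V0 r])
  have "prob {w \<in> space M. A w \<le> x} \<le> prob ({w \<in> space M. W w \<le> x + r} \<union> {w \<in> space M. r \<le> V w})"
    using AW by (intro finite_measure_mono_AE) auto
  also have "\<dots> \<le> prob {w \<in> space M. W w \<le> x + r} + prob {w \<in> space M. r \<le> V w}"
    by (rule measure_Un_le) measurable
  finally have 1: "prob {w \<in> space M. A w \<le> x}
      \<le> prob {w \<in> space M. W w \<le> x + r} + prob {w \<in> space M. r \<le> V w}" .
  have "prob {w \<in> space M. W w \<le> x - r} \<le> prob ({w \<in> space M. A w \<le> x} \<union> {w \<in> space M. r \<le> V w})"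
    using AW by (intro finite_measure_mono_AE) auto
  also have "\<dots> \<le> prob {w \<in> space M. A w \<le> x} + prob {w \<in> space M. r \<le> V w}"
    by (rule measure_Un_le) measurable
  finally have 2: "prob {w \<in> space M. W w \<le> x - r}
      \<le> prob {w \<in> space M. A w \<le> x} + prob {w \<in> space M. r \<le> V w}" .
  show ?thesis
    using 1 2 markov BE[of "x + r"] BE[of "x - r"] r
      cdf_std_normal_Lipschitz[of x "x + r"] cdf_std_normal_Lipschitz[of "x - r" x]
    by (simp add: abs_le_iff)
qed

section \<open>Moments of letter counts\<close>

lemma expectation_discrete:
  fixes I :: "'a \<Rightarrow> nat" and f :: "nat \<Rightarrow> real"
  assumes [measurable]: "random_variable (count_space UNIV) I"
    and int: "integrable M (\<lambda>w. f (I w))"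
  shows "expectation (\<lambda>w. f (I w)) = (\<Sum>\<^sub>\<infinity>i. prob {w \<in> space M. I w = i} * f i)"
proof -
  define q where "q i = prob {w \<in> space M. I w = i}" for i
  let ?\<nu> = "distr M (count_space UNIV) I"
  have \<nu>: "?\<nu> = density (count_space UNIV) (\<lambda>i. ennreal (q i))"
  proof (rule measure_eqI_countable)
    fix i :: nat
    have "emeasure ?\<nu> {i} = ennreal (q i)"
      by (simp add: emeasure_distr q_def emeasure_eq_measure vimage_def Int_def conj_commute)
    also have "\<dots> = emeasure (density (count_space UNIV) (\<lambda>i. ennreal (q i))) {i}"
      by (simp add: emeasure_density)
    finally show "emeasure ?\<nu> {i} = \<dots>" .
  qed auto
  have "integrable ?\<nu> f" by (simp add: integrable_distr_eq int)
  then have "integrable (count_space UNIV) (\<lambda>i. q i * f i)"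
    unfolding \<nu> by (subst (asm) integrable_density) (auto simp: q_def)
  then have abs: "Infinite_Set_Sum.abs_summable_on (\<lambda>i. q i * f i) UNIV"
    by (simp add: Infinite_Set_Sum.abs_summable_on_def)
  have "expectation (\<lambda>w. f (I w)) = integral\<^sup>L ?\<nu> f"
    by (simp add: integral_distr)
  also have "\<dots> = integral\<^sup>L (count_space UNIV) (\<lambda>i. q i * f i)"
    unfolding \<nu> by (subst integral_density) (auto simp: q_def)
  also have "\<dots> = (\<Sum>\<^sub>\<infinity>i. q i * f i)"
    using infsetsum_infsum[OF abs] by (simp add: infsetsum_def)
  finally show ?thesis by (simp add: q_def)
qed

text \<open>The square is expanded over pairs of observations: the n diagonal pairs contribute q
  each, the others q^2 by independence.\<close>

lemma expectation_occ_square: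
  fixes I :: "nat \<Rightarrow> 'a \<Rightarrow> nat"
  assumes indep: "indep_vars (\<lambda>_. count_space UNIV) I {1..}"
    and q: "\<And>k. k \<ge> 1 \<Longrightarrow> prob {w \<in> space M. I k w = i} = q"
  shows "integrable M (\<lambda>w. (occ (\<lambda>k. I k w) n i)\<^sup>2)"
    and "expectation (\<lambda>w. (occ (\<lambda>k. I k w) n i)\<^sup>2) = n * q + n * (real n - 1) * q\<^sup>2"
proof -
  have rv: "random_variable (count_space UNIV) (I k)" if "k \<ge> 1" for k
    using indep that by (auto simp: indep_vars_def2)
  have ev: "{w \<in> space M. I k w = i} \<in> events" if "k \<ge> 1" for k
    using measurable_sets[OF rv[OF that], of "{i}"] by (simp add: vimage_def Int_def conj_commute)
  let ?B = "\<lambda>k l. {w \<in> space M. I k w = i} \<inter> {w \<in> space M. I l w = i}"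
  have eq: "(occ (\<lambda>k. I k w) n i)\<^sup>2 = (\<Sum>k=1..n. \<Sum>l=1..n. indicator (?B k l) w)"
    if "w \<in> space M" for w
    unfolding occ_def power2_eq_square sum_product using that
    by (intro sum.cong refl) (auto split: split_indicator)
  have prob: "prob (?B k l) = (if k = l then q else q\<^sup>2)" if "k \<in> {1..n}" "l \<in> {1..n}" for k l
  proof (cases "k = l")
    case False
    have "prob (\<Inter>j\<in>{k, l}. I j -` {i} \<inter> space M) = (\<Prod>j\<in>{k, l}. prob (I j -` {i} \<inter> space M))"
      by (rule indep_varsD[OF indep]) (use that in auto)
    moreover have "I j -` {i} \<inter> space M = {w \<in> space M. I j w = i}" for j by auto
    ultimately show ?thesis using False q that by (simp add: power2_eq_square)
  qed (use q that in simp)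
  have int: "integrable M (\<lambda>w. \<Sum>k=1..n. \<Sum>l=1..n. indicat_real (?B k l) w)"
    using ev by (intro Bochner_Integration.integrable_sum integrable_real_indicator) (auto simp: emeasure_eq_measure)
  then show "integrable M (\<lambda>w. (occ (\<lambda>k. I k w) n i)\<^sup>2)"
    by (subst Bochner_Integration.integrable_cong[OF refl eq]) auto
  have "expectation (\<lambda>w. (occ (\<lambda>k. I k w) n i)\<^sup>2)
      = expectation (\<lambda>w. \<Sum>k=1..n. \<Sum>l=1..n. indicat_real (?B k l) w)"
    by (rule Bochner_Integration.integral_cong[OF refl eq])
  also have "\<dots> = (\<Sum>k=1..n. \<Sum>l=1..n. prob (?B k l))"
    using ev by (subst Bochner_Integration.integral_sum Bochner_Integration.integrable_sum)+
      (auto intro!: Bochner_Integration.integrable_sum integrable_real_indicator simp: emeasure_eq_measure)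
  also have "\<dots> = (\<Sum>k=1..n. \<Sum>l=1..n. q\<^sup>2 + (if k = l then q - q\<^sup>2 else 0))"
    using prob by (intro sum.cong refl) auto
  also have "\<dots> = n * (n * q\<^sup>2) + n * (q - q\<^sup>2)"
    by (simp add: sum.distrib distrib_left)
  also have "\<dots> = n * q + n * (real n - 1) * q\<^sup>2"
    by (simp add: algebra_simps)
  finally show "expectation (\<lambda>w. (occ (\<lambda>k. I k w) n i)\<^sup>2) = n * q + n * (real n - 1) * q\<^sup>2" .
qed

text \<open>For q > 0 the mean is (1 - q)/n. The bound is uniform in q, so summing over the letters
  below K(n) costs at most K(n)/n.\<close>

lemma expectation_chi_square_le:
  fixes I :: "nat \<Rightarrow> 'a \<Rightarrow> nat"
  assumes indep: "indep_vars (\<lambda>_. count_space UNIV) I {1..}"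
    and q: "\<And>k. k \<ge> 1 \<Longrightarrow> prob {w \<in> space M. I k w = i} = q" and n: "n \<ge> 1"
  shows "integrable M (\<lambda>w. (occ (\<lambda>k. I k w) n i / n)\<^sup>2 / q - occ (\<lambda>k. I k w) n i / n)"
    and "expectation (\<lambda>w. (occ (\<lambda>k. I k w) n i / n)\<^sup>2 / q - occ (\<lambda>k. I k w) n i / n) \<le> 1 / n"
proof -
  have rv: "random_variable (count_space UNIV) (I k)" if "k \<ge> 1" for k
    using indep that by (auto simp: indep_vars_def2)
  have ev: "{w \<in> space M. I k w = i} \<in> events" if "k \<ge> 1" for k
    using measurable_sets[OF rv[OF that], of "{i}"] by (simp add: vimage_def Int_def conj_commute)
  note sq = expectation_occ_square[OF indep q, of n]
  have eq: "occ (\<lambda>k. I k w) n i = (\<Sum>k=1..n. indicator {w \<in> space M. I k w = i} w)"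
    if "w \<in> space M" for w
    unfolding occ_def using that by (intro sum.cong refl) (auto split: split_indicator)
  have int: "integrable M (\<lambda>w. occ (\<lambda>k. I k w) n i)"
    using ev by (subst Bochner_Integration.integrable_cong[OF refl eq])
      (auto intro!: Bochner_Integration.integrable_sum integrable_real_indicator simp: emeasure_eq_measure)
  have E: "expectation (\<lambda>w. occ (\<lambda>k. I k w) n i) = n * q"
  proof -
    have "expectation (\<lambda>w. occ (\<lambda>k. I k w) n i)
        = expectation (\<lambda>w. \<Sum>k=1..n. indicat_real {w \<in> space M. I k w = i} w)"
      by (rule Bochner_Integration.integral_cong[OF refl eq])
    also have "\<dots> = (\<Sum>k=1..n. prob {w \<in> space M. I k w = i})"
      using ev by (subst Bochner_Integration.integral_sum)
        (auto intro!: integrable_real_indicator simp: emeasure_eq_measure)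
    also have "\<dots> = (\<Sum>k=1..n. q)" using q by (intro sum.cong) auto
    finally show ?thesis by simp
  qed
  show "integrable M (\<lambda>w. (occ (\<lambda>k. I k w) n i / n)\<^sup>2 / q - occ (\<lambda>k. I k w) n i / n)"
    using sq(1) int by (simp add: power_divide)
  have q01: "0 \<le> q" "q \<le> 1" using q[of 1] prob_le_1 measure_nonneg[of M] by force+
  have "expectation (\<lambda>w. (occ (\<lambda>k. I k w) n i / n)\<^sup>2 / q - occ (\<lambda>k. I k w) n i / n)
      = (n * q + n * (real n - 1) * q\<^sup>2) / (real n)\<^sup>2 / q - n * q / n"
    using sq int by (simp add: power_divide E)
  also have "\<dots> \<le> 1 / n"
  \<comment> \<open>For q = 0, division by zero makes the left-hand side 0.\<close>
  proof (cases "q = 0")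
    case False
    then have "(n * q + n * (real n - 1) * q\<^sup>2) / (real n)\<^sup>2 / q - n * q / n = (1 - q) / n"
      using n by (simp add: field_simps power2_eq_square)
    then show ?thesis using q01 n by (simp add: divide_right_mono)
  qed simp
  finally show "expectation (\<lambda>w. (occ (\<lambda>k. I k w) n i / n)\<^sup>2 / q - occ (\<lambda>k. I k w) n i / n) \<le> 1 / n" .
qed

end

lemma powr_add_le:
  fixes u v s :: real
  assumes "0 \<le> u" "0 \<le> v" "0 \<le> s"
  shows "(u + v) powr s \<le> 2 powr s * (u powr s + v powr s)"
proof -
  have "(u + v) powr s \<le> (2 * max u v) powr s"
    using assms by (intro powr_mono2) auto
  also have "\<dots> = 2 powr s * max u v powr s" using assms by (simp add: powr_mult)
  also have "\<dots> \<le> 2 powr s * (u powr s + v powr s)"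
    by (intro mult_left_mono) (auto simp: max_def)
  finally show ?thesis .
qed

text \<open>The estimator sees only the first n observations. This serves both to replace letters by
  indices and to restrict to finitely many coordinates.\<close>

lemma jackknife_entropy_cong:
  assumes "\<And>k. k \<in> {1..n} \<Longrightarrow> X k w = X' k w'"
  shows "jackknife_entropy a X n w = jackknife_entropy a X' n w'"
proof -
  have occ: "(\<Sum>k=1..n. of_bool (X k w = a i)) = (\<Sum>k=1..n. of_bool (X' k w' = a i) :: real)" for i
    using assms by (intro sum.cong) auto
  have "plugin_entropy a X n w = plugin_entropy a X' n w'"
    by (simp only: plugin_entropy_def emp_freq_def[abs_def] occ)
  moreover have "plugin_entropy_del a X n j w = plugin_entropy_del a X' n j w'" if "j \<in> {1..n}" for j
    by (simp only: plugin_entropy_del_def emp_freq_del_def[abs_def] occ assms[OF that])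
  ultimately show ?thesis by (simp add: jackknife_entropy_def)
qed

section \<open>The rate of convergence\<close>

theorem theorem3p3:
  fixes M :: "'w measure"
    and a :: "nat \<Rightarrow> 'a"
    and X :: "nat \<Rightarrow> 'w \<Rightarrow> 'a"
    and p :: "nat \<Rightarrow> real"
    and K :: "nat \<Rightarrow> nat"
    and \<delta> \<epsilon> C0 \<sigma> :: real
  assumes "prob_space M"
    and "inj_on a {1..}"
    and "prob_space.indep_vars M (\<lambda>_. count_space (a ` {1..})) X {1..}"
    and "\<And>k. k \<ge> 1 \<Longrightarrow>
           distr M (count_space (a ` {1..})) (X k) = distr M (count_space (a ` {1..})) (X 1)"
    and "\<And>i. i \<ge> 1 \<Longrightarrow> p i = measure M {w \<in> space M. X 1 w = a i}"
    and "nonuniform p"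
    and "0 < \<delta>" and "\<delta> < 1/2"
    and "integrable M (\<lambda>w. \<bar>ln (letter_mass a p (X 1 w))\<bar> powr (2 + \<delta>))"
    and "\<And>n. n \<ge> 1 \<Longrightarrow> K n \<ge> 1"
    and "\<And>n. n \<ge> 1 \<Longrightarrow> real (K n) \<le> real n powr (1/2 - \<delta>)"
    and "\<And>n. n \<ge> 1 \<Longrightarrow>
           real n powr (1/2 + \<delta>) * ln (real n) * (\<Sum>\<^sub>\<infinity>i\<in>{K n..}. p i) \<le> C0"
    and "\<And>n. n \<ge> 1 \<Longrightarrow>
           - (real n powr (1/2 + \<delta>)) * (\<Sum>\<^sub>\<infinity>i\<in>{K n..}. p i * ln (p i)) \<le> C0"
    and "1/2 < \<epsilon>" and "\<epsilon> < 1"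
    and "(\<lambda>i. p i powr (1 - \<epsilon>)) summable_on {1..}"
    and "\<sigma>\<^sup>2 = prob_space.variance M (\<lambda>w. ln (letter_mass a p (X 1 w)))"
    and "\<sigma> > 0"
  shows "\<exists>C>0. \<forall>n\<ge>2.
    (SUP x. \<bar>measure M {w \<in> space M.
                 sqrt (real n) / \<sigma> * (jackknife_entropy a X n w - entropy_of p) \<le> x}
              - cdf std_normal_distribution x\<bar>)
      \<le> C * real n powr (- \<delta> / 2) + C * real n powr (1/4 - \<epsilon> / 2)"
proof -
  interpret prob_space M by fact
  note inj = assms(2) and X_indep = assms(3) and X_distr = assms(4) and \<delta> = assms(7,8)

  \<comment> \<open>Passage from letters to indices\<close>
  let ?cs = "count_space (a ` {1..})"
  \<comment> \<open>In terms of indices, \<open>letter_mass a p (X k w)\<close> becomes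
    \<open>p (I k w)\<close>, and every function of an index is measurable because the index space
    is discrete.\<close>
  define I where "I k w = inv_into {1..} a (X k w)" for k w
  have X_rv: "random_variable ?cs (X k)" if "k \<ge> 1" for k
    using X_indep that by (auto simp: indep_vars_def2)
  have aI: "a (I k w) = X k w" "I k w \<ge> 1" if "k \<ge> 1" "w \<in> space M" for k w
  proof -
    have "X k w \<in> a ` {1..}" using measurable_space[OF X_rv[OF that(1)] that(2)] by simp
    then show "a (I k w) = X k w" "I k w \<ge> 1"
      using inv_into_into[of "X k w" a "{1..}"] by (auto simp: I_def f_inv_into_f)
  qed
  have inv_m: "inv_into {1..} a \<in> ?cs \<rightarrow>\<^sub>M count_space UNIV" by simp
  have I_rv: "random_variable (count_space UNIV) (I k)" if "k \<ge> 1" for k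
    unfolding I_def[abs_def] by (rule measurable_compose[OF X_rv[OF that] inv_m])
  have I_indep: "indep_vars (\<lambda>_. count_space UNIV) I {1..}"
    unfolding I_def[abs_def] by (rule indep_vars_compose2[OF X_indep]) simp
  have I_distr: "distr M (count_space UNIV) (I k) = distr M (count_space UNIV) (I 1)" if "k \<ge> 1" for k
  proof -
    have "distr M (count_space UNIV) (I k) = distr (distr M ?cs (X k)) (count_space UNIV) (inv_into {1..} a)"
      if "k \<ge> 1" for k
      using distr_distr[OF inv_m X_rv[OF that]] by (simp add: I_def[abs_def] comp_def)
    from this[OF that] this[of 1] show ?thesis using X_distr[OF that] by simp
  qed
  have E_I: "integrable M (\<lambda>w. f (I k w))" "expectation (\<lambda>w. f (I k w)) = expectation (\<lambda>w. f (I 1 w))"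
    if "k \<ge> 1" "integrable M (\<lambda>w. f (I 1 w))" for k and f :: "nat \<Rightarrow> real"
  proof -
    have "integrable (distr M (count_space UNIV) (I 1)) f"
      using that I_rv[of 1] by (simp add: integrable_distr_eq)
    then show "integrable M (\<lambda>w. f (I k w))"
      unfolding I_distr[OF that(1), symmetric] by (subst (asm) integrable_distr_eq[OF I_rv[OF that(1)]]) auto
    show "expectation (\<lambda>w. f (I k w)) = expectation (\<lambda>w. f (I 1 w))"
      using integral_distr[OF I_rv[OF that(1)], of f] integral_distr[OF I_rv[of 1], of f]
      by (simp add: I_distr[OF that(1)])
  qed
  have I_ev: "{w \<in> space M. I k w = i} \<in> events" if "k \<ge> 1" for k i
    using measurable_sets[OF I_rv[OF that], of "{i}"] by (simp add: vimage_def Int_def conj_commute)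
  have pI: "prob {w \<in> space M. I k w = i} = p i" if "i \<ge> 1" "k \<ge> 1" for i k
  proof -
    have "prob {w \<in> space M. I k w = i} = measure (distr M (count_space UNIV) (I k)) {i}"
      using I_rv[OF that(2)] by (simp add: measure_distr vimage_def Int_def conj_commute)
    also have "\<dots> = measure (distr M (count_space UNIV) (I 1)) {i}"
      by (simp only: I_distr[OF that(2)])
    also have "\<dots> = prob {w \<in> space M. I 1 w = i}"
      using I_rv[of 1] by (simp add: measure_distr vimage_def Int_def conj_commute)
    also have "{w \<in> space M. I 1 w = i} = {w \<in> space M. X 1 w = a i}"
    proof -
      have "X 1 w = a i \<longleftrightarrow> I 1 w = i" if "w \<in> space M" for w
        using inj_on_eq_iff[OF inj, of "I 1 w" i] aI[of 1 w] that \<open>i \<ge> 1\<close> by simp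
      then show ?thesis by blast
    qed
    finally show ?thesis using assms(5)[OF that(1)] by simp
  qed
  have p_nonneg: "p i \<ge> 0" if "i \<ge> 1" for i using assms(5)[OF that] by simp
  have sum_p: "sum p S \<le> 1" if "finite S" "S \<subseteq> {1..}" for S
  proof -
    interpret \<nu>: prob_space "distr M (count_space UNIV) (I 1)"
      by (rule prob_space_distr) (simp add: I_rv)
    have "sum p S = (\<Sum>i\<in>S. measure (distr M (count_space UNIV) (I 1)) {i})"
      using that(2) pI[of _ 1] I_rv[of 1]
      by (intro sum.cong) (auto simp: measure_distr vimage_def Int_def conj_commute subset_iff)
    also have "\<dots> = measure (distr M (count_space UNIV) (I 1)) S"
      using that by (intro \<nu>.finite_measure_eq_sum_singleton[symmetric]) auto
    finally show ?thesis using \<nu>.prob_le_1 by simp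
  qed
  \<comment> \<open>A countable union of null events is null. The remainder bound takes ln p at the
    observed letters and needs these probabilities positive.\<close>
  have pos: "AE w in M. p (I k w) > 0" if "k \<ge> 1" for k
  proof -
    have "AE w in M. I k w \<noteq> i" if "i \<ge> 1" "p i = 0" for i
      using prob_Collect_eq_0[OF I_ev[OF \<open>k \<ge> 1\<close>, of i]] pI[OF that(1) \<open>k \<ge> 1\<close>] that(2) by simp
    then have "AE w in M. \<forall>i. i \<ge> 1 \<and> p i = 0 \<longrightarrow> I k w \<noteq> i"
      unfolding AE_all_countable by auto
    then show ?thesis
    proof (rule AE_mp, intro AE_I2 impI)
      fix w assume "w \<in> space M" "\<forall>i. i \<ge> 1 \<and> p i = 0 \<longrightarrow> I k w \<noteq> i"
      then show "p (I k w) > 0" using aI(2)[OF that] p_nonneg[of "I k w"] by force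
    qed
  qed
  have E_sum: "expectation (\<lambda>w. f (I 1 w)) = (\<Sum>\<^sub>\<infinity>i\<in>{1..}. p i * f i)"
    if "integrable M (\<lambda>w. f (I 1 w))" for f
  proof -
    \<comment> \<open>The sum over all naturals may start at 1, since 0 is never the index of a
      letter.\<close>
    have "{w \<in> space M. I 1 w = 0} = {}" using aI(2)[of 1] by force
    then have "prob {w \<in> space M. I 1 w = 0} = 0" by (simp only: measure_empty)
    then have "(\<Sum>\<^sub>\<infinity>i. prob {w \<in> space M. I 1 w = i} * f i) = (\<Sum>\<^sub>\<infinity>i\<in>{1..}. p i * f i)"
      by (intro infsum_cong_neutral) (auto simp: pI not_le)
    then show ?thesis using expectation_discrete[OF I_rv[of 1] that] by simp
  qed

  \<comment> \<open>Standardised information contents and their normal approximation\<close>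
  define H where "H = entropy_of p"
  define l where "l i = ln (p i)" for i
  have l_rv: "random_variable borel (\<lambda>w. l (I 1 w))"
    by (rule measurable_compose[OF I_rv]) auto
  have l_mom: "integrable M (\<lambda>w. \<bar>l (I 1 w)\<bar> powr (2 + \<delta>))"
    using assms(9) by (simp add: l_def I_def letter_mass_def)
  have l_int: "integrable M (\<lambda>w. (l (I 1 w))\<^sup>2)" "integrable M (\<lambda>w. l (I 1 w))"
    using integrable_powr_imp_square[OF l_rv l_mom] \<delta> by auto
  have l_mean: "expectation (\<lambda>w. l (I 1 w)) = - H"
    using E_sum[OF l_int(2)] by (simp add: H_def entropy_of_def l_def)
  have l_var: "expectation (\<lambda>w. (l (I 1 w) + H)\<^sup>2) = \<sigma>\<^sup>2"
    using assms(17) l_mean by (simp add: l_def I_def letter_mass_def)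

  define Y where "Y k w = - (l (I k w) + H) / \<sigma>" for k w
  have Y_indep: "indep_vars (\<lambda>_. borel) Y {1..}"
    unfolding Y_def[abs_def] by (rule indep_vars_compose2[OF I_indep]) simp
  have Y_rv: "random_variable borel (Y k)" if "k \<ge> 1" for k
    using Y_indep that by (auto simp: indep_vars_def2)
  have Y_distr: "distr M borel (Y k) = distr M borel (Y 1)" if "k \<ge> 1" for k
  proof -
    have "distr M borel (Y k) = distr (distr M (count_space UNIV) (I k)) borel (\<lambda>i. - (l i + H) / \<sigma>)"
      if "k \<ge> 1" for k
      using distr_distr[OF _ I_rv[OF that], of "\<lambda>i. - (l i + H) / \<sigma>" borel] by (simp add: Y_def[abs_def] comp_def)
    from this[OF that] this[of 1] show ?thesis using I_distr[OF that] by simp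
  qed
  have Y_mom: "integrable M (\<lambda>w. \<bar>Y 1 w\<bar> powr (2 + \<delta>))"
  proof (rule Bochner_Integration.integrable_bound)
    let ?g = "\<lambda>w. 2 powr (2 + \<delta>) * (\<bar>l (I 1 w)\<bar> powr (2 + \<delta>) + \<bar>H\<bar> powr (2 + \<delta>)) / \<sigma> powr (2 + \<delta>)"
    show "integrable M ?g" using l_mom by simp
    show "(\<lambda>w. \<bar>Y 1 w\<bar> powr (2 + \<delta>)) \<in> borel_measurable M" using Y_rv[of 1] by simp
    have "\<bar>Y 1 w\<bar> powr (2 + \<delta>) \<le> ?g w" for w
    proof -
      have "\<bar>Y 1 w\<bar> = \<bar>l (I 1 w) + H\<bar> / \<sigma>"
        using \<open>\<sigma> > 0\<close> by (simp only: Y_def abs_divide abs_minus_cancel abs_of_pos)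
      then have "\<bar>Y 1 w\<bar> powr (2 + \<delta>) = \<bar>l (I 1 w) + H\<bar> powr (2 + \<delta>) / \<sigma> powr (2 + \<delta>)"
        using \<open>\<sigma> > 0\<close> by (simp add: powr_divide)
      also have "\<dots> \<le> (\<bar>l (I 1 w)\<bar> + \<bar>H\<bar>) powr (2 + \<delta>) / \<sigma> powr (2 + \<delta>)"
        using \<delta> by (intro divide_right_mono powr_mono2) auto
      also have "\<dots> \<le> ?g w"
        using \<delta> by (intro divide_right_mono powr_add_le) auto
      finally show ?thesis .
    qed
    then show "AE w in M. norm (\<bar>Y 1 w\<bar> powr (2 + \<delta>)) \<le> norm (?g w)"
      by (intro AE_I2) (auto intro: order_trans[OF _ abs_ge_self])
  qed
  have Y_mean: "expectation (Y 1) = 0"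
    using l_int l_mean by (simp add: Y_def[abs_def] prob_space)
  have Y_var: "expectation (\<lambda>w. (Y 1 w)\<^sup>2) = 1"
    unfolding Y_def power_divide power2_minus using l_var \<open>\<sigma> > 0\<close> by simp
  obtain C1 where C1: "C1 \<ge> 0" and BE: "\<And>n x. n \<ge> 2 \<Longrightarrow>
      \<bar>prob {w \<in> space M. (\<Sum>k=1..n. Y k w) / sqrt (real n) \<le> x} - cdf std_normal_distribution x\<bar>
        \<le> C1 * real n powr (- \<delta> / 2)"
    using Berry_Esseen_moment[OF Y_indep Y_distr Y_mom _ _ Y_mean Y_var] \<delta> by auto

  \<comment> \<open>The jackknife as a random variable of the indices\<close>
  define J where "J n w = jackknife_entropy a (\<lambda>k t. a (t k)) n (\<lambda>k. I k w)" for n w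
  have J_eq: "jackknife_entropy a X n w = J n w" if "w \<in> space M" for n w
    unfolding J_def using aI(1) that by (intro jackknife_entropy_cong) simp
  have J_rv: "random_variable borel (J n)" for n
  proof -
    let ?F = "\<lambda>t. jackknife_entropy a (\<lambda>k t. a (t k)) n t"
    \<comment> \<open>A finite product of countable discrete spaces is discrete, so any function of
      the first n indices is measurable and the infinite sums in the estimator need no
      inspection.\<close>
    have "(\<lambda>w. restrict (\<lambda>k. I k w) {1..n}) \<in> M \<rightarrow>\<^sub>M PiM {1..n} (\<lambda>_. count_space UNIV)"
      by (intro measurable_restrict I_rv) auto
    then have "(\<lambda>w. restrict (\<lambda>k. I k w) {1..n}) \<in> M \<rightarrow>\<^sub>M count_space (PiE {1..n} (\<lambda>_. UNIV))"
      by (subst (asm) count_space_PiM_finite) auto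
    then have "(\<lambda>w. ?F (restrict (\<lambda>k. I k w) {1..n})) \<in> borel_measurable M"
      by (rule measurable_compose) simp
    moreover have "?F (restrict (\<lambda>k. I k w) {1..n}) = J n w" for w
      unfolding J_def by (rule jackknife_entropy_cong) simp
    ultimately show ?thesis by (simp add: fun_eq_iff cong: measurable_cong)
  qed

  \<comment> \<open>Expected size of the remainder\<close>
  define T1 where "T1 N = - (\<Sum>\<^sub>\<infinity>i\<in>{N..}. p i * ln (p i))" for N
  define T2 where "T2 N = (\<Sum>\<^sub>\<infinity>i\<in>{N..}. p i)" for N
  have tail: "integrable M (\<lambda>w. of_bool (N \<le> I k w) * f (I k w))"
      "expectation (\<lambda>w. of_bool (N \<le> I k w) * f (I k w)) = (\<Sum>\<^sub>\<infinity>i\<in>{N..}. p i * f i)"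
    if f: "integrable M (\<lambda>w. f (I 1 w))" and N: "N \<ge> 1" and k: "k \<ge> 1" for f N k
  proof -
    have int: "integrable M (\<lambda>w. of_bool (N \<le> I 1 w) * f (I 1 w))"
    proof (rule Bochner_Integration.integrable_bound[OF f])
      show "(\<lambda>w. of_bool (N \<le> I 1 w) * f (I 1 w)) \<in> borel_measurable M"
        by (rule measurable_compose[OF I_rv[of 1]]) auto
    qed auto
    show "integrable M (\<lambda>w. of_bool (N \<le> I k w) * f (I k w))"
      by (rule E_I(1)[OF k int])
    have "expectation (\<lambda>w. of_bool (N \<le> I k w) * f (I k w)) = (\<Sum>\<^sub>\<infinity>i\<in>{1..}. p i * (of_bool (N \<le> i) * f i))"
      using E_I(2)[OF k int] E_sum[OF int] by simp
    also have "\<dots> = (\<Sum>\<^sub>\<infinity>i\<in>{N..}. p i * f i)"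
      using N by (intro infsum_cong_neutral) auto
    finally show "expectation (\<lambda>w. of_bool (N \<le> I k w) * f (I k w)) = (\<Sum>\<^sub>\<infinity>i\<in>{N..}. p i * f i)" .
  qed
  have tail1: "integrable M (\<lambda>w. of_bool (N \<le> I k w) * - ln (p (I k w)))"
      "expectation (\<lambda>w. of_bool (N \<le> I k w) * - ln (p (I k w))) = T1 N"
    if "N \<ge> 1" "k \<ge> 1" for N k
  proof -
    have int: "integrable M (\<lambda>w. - ln (p (I 1 w)))" using l_int(2) by (simp add: l_def)
    show "integrable M (\<lambda>w. of_bool (N \<le> I k w) * - ln (p (I k w)))"
      by (rule tail(1)[of "\<lambda>i. - ln (p i)", OF int that])
    have "T1 N = (\<Sum>\<^sub>\<infinity>i\<in>{N..}. p i * - ln (p i))"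
      unfolding T1_def by (subst infsum_uminus[symmetric]) simp
    then show "expectation (\<lambda>w. of_bool (N \<le> I k w) * - ln (p (I k w))) = T1 N"
      using tail(2)[of "\<lambda>i. - ln (p i)", OF int that] by (simp only:)
  qed
  have tail2: "integrable M (\<lambda>w. of_bool (N \<le> I k w) :: real)"
      "expectation (\<lambda>w. of_bool (N \<le> I k w)) = T2 N"
    if "N \<ge> 1" "k \<ge> 1" for N k
    using tail[of "\<lambda>i. 1" N k] that by (auto simp: T2_def)
  have T2_nonneg: "T2 N \<ge> 0" if "N \<ge> 1" for N
    unfolding T2_def using p_nonneg that by (intro infsum_nonneg) auto
  have C0: "C0 \<ge> 0"
  proof -
    have "0 \<le> real 2 powr (1/2 + \<delta>) * ln (real 2) * T2 (K 2)"
      using T2_nonneg[OF assms(10)[of 2]] by simp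
    also have "\<dots> \<le> C0" unfolding T2_def by (rule assms(12)) simp
    finally show ?thesis .
  qed

  \<comment> \<open>The right-hand side of \<open>jackknife_remainder_le\<close> with cutoff
    \<open>K n\<close>.\<close>
  define V where "V n w = (\<Sum>i\<in>{1..<K n}. (occ (\<lambda>k. I k w) n i / n)\<^sup>2 / p i - occ (\<lambda>k. I k w) n i / n)
      + (\<Sum>k=1..n. of_bool (K n \<le> I k w) * - ln (p (I k w))) / n
      + (real (K n) + (\<Sum>k=1..n. of_bool (K n \<le> I k w))) / n" for n w
  have V_int: "integrable M (V n)" if n: "n \<ge> 1" for n
    unfolding V_def[abs_def]
    using tail1(1) tail2(1) assms(10)[OF n] n pI
    by (intro Bochner_Integration.integrable_add Bochner_Integration.integrable_sum integrable_divide
        expectation_chi_square_le(1)[OF I_indep]) auto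
  \<comment> \<open>\<open>K n\<close> enters twice: through the chi-square terms, each of mean at
    most 1/n, and through the number of distinct letters below the cutoff.\<close>
  have V_E: "expectation (V n) \<le> (2 * real (K n)) / n + T1 (K n) + T2 (K n)" if n: "n \<ge> 1" for n
  proof -
    note K = assms(10)[OF n]
    have int1: "integrable M (\<lambda>w. (occ (\<lambda>k. I k w) n i / n)\<^sup>2 / p i - occ (\<lambda>k. I k w) n i / n)"
      if "i \<in> {1..<K n}" for i
      using that n pI by (intro expectation_chi_square_le(1)[OF I_indep]) auto
    let ?A = "\<lambda>w. \<Sum>i\<in>{1..<K n}. (occ (\<lambda>k. I k w) n i / n)\<^sup>2 / p i - occ (\<lambda>k. I k w) n i / n"
    let ?B = "\<lambda>w. \<Sum>k=1..n. of_bool (K n \<le> I k w) * - ln (p (I k w))"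
    let ?D = "\<lambda>w. \<Sum>k=1..n. of_bool (K n \<le> I k w) :: real"
    have A: "integrable M ?A"
      by (rule Bochner_Integration.integrable_sum) (rule int1)
    have "expectation ?A = (\<Sum>i\<in>{1..<K n}. expectation (\<lambda>w. (occ (\<lambda>k. I k w) n i / n)\<^sup>2 / p i - occ (\<lambda>k. I k w) n i / n))"
      by (rule Bochner_Integration.integral_sum) (rule int1)
    also have "\<dots> \<le> (\<Sum>i\<in>{1..<K n}. 1 / n)"
      using n pI by (intro sum_mono expectation_chi_square_le(2)[OF I_indep]) auto
    also have "\<dots> \<le> real (K n) / n"
      by (simp add: divide_right_mono)
    finally have EA: "expectation ?A \<le> real (K n) / n" .
    have intB: "integrable M (\<lambda>w. of_bool (K n \<le> I k w) * - ln (p (I k w)))" if "k \<in> {1..n}" for k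
      using that by (intro tail1(1)[OF K]) simp
    have B: "integrable M ?B"
      by (rule Bochner_Integration.integrable_sum) (rule intB)
    have "expectation ?B = (\<Sum>k=1..n. expectation (\<lambda>w. of_bool (K n \<le> I k w) * - ln (p (I k w))))"
      by (rule Bochner_Integration.integral_sum) (rule intB)
    also have "\<dots> = (\<Sum>k=1..n. T1 (K n))"
      by (rule sum.cong) (simp_all only: tail1(2)[OF K] atLeastAtMost_iff)
    finally have EB: "expectation ?B = n * T1 (K n)" by simp
    have intD: "integrable M (\<lambda>w. of_bool (K n \<le> I k w) :: real)" if "k \<in> {1..n}" for k
      using that by (intro tail2(1)[OF K]) simp
    have D: "integrable M ?D"
      by (rule Bochner_Integration.integrable_sum) (rule intD)
    have "expectation ?D = (\<Sum>k=1..n. expectation (\<lambda>w. of_bool (K n \<le> I k w)))"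
      by (rule Bochner_Integration.integral_sum) (rule intD)
    also have "\<dots> = (\<Sum>k=1..n. T2 (K n))"
      by (rule sum.cong) (simp_all only: tail2(2)[OF K] atLeastAtMost_iff)
    finally have ED: "expectation ?D = n * T2 (K n)" by simp
    have "expectation (V n) = expectation ?A + expectation ?B / n + (real (K n) + expectation ?D) / n"
      unfolding V_def[abs_def] using A B D
      by (simp only: Bochner_Integration.integral_add Bochner_Integration.integrable_add integrable_divide
          integral_divide_zero integrable_const) (simp add: prob_space)
    also have "\<dots> \<le> real (K n) / n + n * T1 (K n) / n + (real (K n) + n * T2 (K n)) / n"
      unfolding EB ED using EA by simp
    also have "\<dots> = (2 * real (K n)) / n + T1 (K n) + T2 (K n)"
      using n by (simp add: add_divide_distrib)
    finally show ?thesis .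
  qed
  \<comment> \<open>One summand for each term of \<open>V_E\<close>; ln 2 appears because ln n \<ge>
    ln 2 is used to remove the logarithm from the bound on \<open>T2\<close>.\<close>
  define C2 where "C2 = 2 + C0 + C0 / ln 2"
  have C2: "C2 \<ge> 0" using C0 by (simp add: C2_def)
  have V_E2: "sqrt n * expectation (V n) \<le> C2 * n powr (- \<delta>)" if n: "n \<ge> 2" for n :: nat
  proof -
    have n1: "n \<ge> 1" using n by simp
    define N where "N = real n"
    have N: "N \<ge> 2" "N > 0" using n by (auto simp: N_def)
    have split: "N powr (1/2) = N powr (- \<delta>) * N powr (1/2 + \<delta>)"
      by (simp flip: powr_add)
    have "N powr (1/2) * (2 * real (K n) / N) \<le> N powr (1/2) * (2 * N powr (1/2 - \<delta>) / N)"
      using assms(11)[OF n1] N by (intro mult_left_mono divide_right_mono) (auto simp: N_def)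
    also have "\<dots> = 2 * (N powr (1/2) * N powr (1/2 - \<delta>)) / N powr 1"
      using N by simp
    also have "\<dots> = 2 * N powr (- \<delta>)"
      unfolding powr_add[symmetric] times_divide_eq_right[symmetric] powr_diff[symmetric] by simp
    finally have 1: "N powr (1/2) * (2 * real (K n) / N) \<le> 2 * N powr (- \<delta>)" .
    have "N powr (1/2 + \<delta>) * T1 (K n) \<le> C0"
      using assms(13)[OF n1] by (simp add: T1_def N_def)
    then have 2: "N powr (1/2) * T1 (K n) \<le> C0 * N powr (- \<delta>)"
      unfolding split mult.assoc by (subst mult.commute, intro mult_right_mono) auto
    have "N powr (1/2 + \<delta>) * T2 (K n) * ln 2 \<le> N powr (1/2 + \<delta>) * T2 (K n) * ln N"
      using N T2_nonneg[OF assms(10)[OF n1]] by (intro mult_left_mono) auto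
    also have "\<dots> \<le> C0"
      using assms(12)[OF n1] by (simp add: T2_def N_def ac_simps)
    finally have "N powr (1/2 + \<delta>) * T2 (K n) \<le> C0 / ln 2"
      by (simp add: pos_le_divide_eq)
    then have 3: "N powr (1/2) * T2 (K n) \<le> C0 / ln 2 * N powr (- \<delta>)"
      unfolding split mult.assoc by (subst mult.commute, intro mult_right_mono) auto
    have "N powr (1/2) * expectation (V n) \<le> N powr (1/2) * (2 * real (K n) / N + T1 (K n) + T2 (K n))"
      using V_E[OF n1] by (intro mult_left_mono) (auto simp: N_def)
    also have "\<dots> \<le> C2 * N powr (- \<delta>)"
      using 1 2 3 unfolding C2_def distrib_left distrib_right by linarith
    finally show ?thesis using N by (simp add: powr_half_sqrt N_def)
  qed

  \<comment> \<open>\<open>C1\<close> is the Berry-Esseen constant, 1 accounts for the Markov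
    threshold, and \<open>C2 / \<sigma>\<close> for the exceptional probability: n powr (- \<delta>)
    divided by the threshold n powr (- \<delta>/2) is that threshold again.\<close>
  define C where "C = C1 + 1 + C2 / \<sigma>"
  have C: "C > 0" using C1 C2 \<open>\<sigma> > 0\<close> by (simp add: C_def add_pos_nonneg add_nonneg_pos)
  have main: "\<bar>prob {w \<in> space M. sqrt (real n) / \<sigma> * (jackknife_entropy a X n w - entropy_of p) \<le> x}
      - cdf std_normal_distribution x\<bar> \<le> C * real n powr (- \<delta> / 2)" if n: "n \<ge> 2" for n x
  proof -
    have n1: "n \<ge> 1" using n by simp
    let ?A = "\<lambda>w. sqrt (real n) / \<sigma> * (J n w - H)"
    let ?W = "\<lambda>w. (\<Sum>k=1..n. Y k w) / sqrt (real n)"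
    let ?V = "\<lambda>w. sqrt (real n) / \<sigma> * V n w"
    let ?r = "real n powr (- \<delta> / 2)"
    have "\<bar>prob {w \<in> space M. ?A w \<le> x} - cdf std_normal_distribution x\<bar>
      \<le> C1 * ?r + ?r + expectation ?V / ?r"
    proof (rule cdf_perturbation)
      show "random_variable borel ?W"
        by (intro borel_measurable_divide borel_measurable_sum Y_rv) auto
      show "random_variable borel ?A" using J_rv[of n] by simp
      show "integrable M ?V" using V_int[OF n1] by simp
      have "AE w in M. \<forall>k\<in>{1..n}. p (I k w) > 0"
        by (intro AE_finite_allI pos) auto
      then show "AE w in M. \<bar>?A w - ?W w\<bar> \<le> ?V w"
      proof (rule AE_mp, intro AE_I2 impI)
        fix w assume w: "w \<in> space M" and p: "\<forall>k\<in>{1..n}. p (I k w) > 0"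
        have "\<bar>J n w + (\<Sum>k=1..n. ln (p (I k w))) / n\<bar> \<le> V n w"
          unfolding J_def V_def
          by (rule jackknife_remainder_le[OF inj _ n _ sum_p]) (use aI(2)[OF _ w] p in auto)
        \<comment> \<open>Every \<open>Y k\<close> carries a copy of \<open>H\<close>, so the
          entropies cancel and exactly the scaled remainder is left.\<close>
        moreover have "?A w - ?W w = sqrt (real n) / \<sigma> * (J n w + (\<Sum>k=1..n. ln (p (I k w))) / n)"
        proof -
          define L where "L = (\<Sum>k=1..n. ln (p (I k w)))"
          define s where "s = sqrt (real n)"
          have s: "s > 0" "real n = s * s" using n by (simp_all add: s_def)
          have "(\<Sum>k=1..n. Y k w) = (\<Sum>k=1..n. - (l (I k w) + H)) / \<sigma>"
            by (simp only: Y_def sum_divide_distrib)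
          also have "(\<Sum>k=1..n. - (l (I k w) + H)) = - (L + s * s * H)"
            unfolding sum_negf sum.distrib by (simp add: L_def l_def s(2)[symmetric])
          finally have "(\<Sum>k=1..n. Y k w) = - (L + s * s * H) / \<sigma>" .
          then show ?thesis
            unfolding L_def[symmetric] s_def[symmetric] s(2)
            using s(1) \<open>\<sigma> > 0\<close> by (simp add: field_simps)
        qed
        ultimately show "\<bar>?A w - ?W w\<bar> \<le> ?V w"
          using \<open>\<sigma> > 0\<close> by (simp add: abs_mult mult_left_mono divide_right_mono)
      qed
      show "0 < ?r" using n by simp
    qed (rule BE[OF n])
    also have "expectation ?V / ?r \<le> (C2 * n powr (- \<delta>) / \<sigma>) / ?r"
      using V_E2[OF n] \<open>\<sigma> > 0\<close> by (intro divide_right_mono) (auto simp: divide_right_mono)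
    also have "(C2 * n powr (- \<delta>) / \<sigma>) / ?r = C2 / \<sigma> * ?r"
    proof -
      have "n powr (- \<delta>) = ?r * ?r" by (simp flip: powr_add)
      then show ?thesis using n by simp
    qed
    also have "{w \<in> space M. ?A w \<le> x}
        = {w \<in> space M. sqrt (real n) / \<sigma> * (jackknife_entropy a X n w - entropy_of p) \<le> x}"
      using J_eq by (auto simp: H_def)
    finally show ?thesis by (simp add: C_def algebra_simps)
  qed
  show ?thesis
  proof (intro exI[of _ C] conjI C allI impI)
    fix n :: nat assume n: "n \<ge> 2"
    have "(SUP x. \<bar>prob {w \<in> space M. sqrt (real n) / \<sigma> * (jackknife_entropy a X n w - entropy_of p) \<le> x}
        - cdf std_normal_distribution x\<bar>) \<le> C * real n powr (- \<delta> / 2)"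
      using main[OF n] by (intro cSUP_least) auto
    also have "\<dots> \<le> C * real n powr (- \<delta> / 2) + C * real n powr (1/4 - \<epsilon> / 2)"
      using C by simp
    finally show "(SUP x. \<bar>prob {w \<in> space M. sqrt (real n) / \<sigma> * (jackknife_entropy a X n w - entropy_of p) \<le> x}
        - cdf std_normal_distribution x\<bar>) \<le> C * real n powr (- \<delta> / 2) + C * real n powr (1/4 - \<epsilon> / 2)" .
  qed
qed

end
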